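(* The nucleolus can be found in time $O(n^4)$ for single market uncapacitated production-distribution games: there is an algorithm that, given the profits $\alpha_1,\dots,\alpha_n$ and demands $d_1,\dots,d_n$ of such a game $(N,v)$ with $n$ players, computes its nucleolus in time $O(n^4)$.
   Context: Single market uncapacitated production-distribution game: players $N=\{1,\dots,n\}$, per-unit profits $\alpha_i\ge 0$ and demands $d_i\ge 0$ for $i\in N$; the value of a nonempty $S\subseteq N$ is $v(S)=\big(\sum_{i\in S}d_i\big)\cdot\max_{k\in S}\alpha_k$, and $v(\emptyset)=0$. Nucleolus: for $x\in\mathbb{R}^n$ with $x(N)=v(N)$, where $x(S)=\sum_{i\in S}x_i$, let $e_S(x)=x(S)-v(S)$ be the excess of $S\subseteq N$ and let $\overrightarrow{e(x)}\in\mathbb{R}^{2^n}$ be the vector of all excesses arranged in non-decreasing order. The nucleolus of $(N,v)$ (a game with nonempty core) is the set of $x$ with $x(N)=v(N)$ for which $\overrightarrow{e(x)}$ is lexicographically maximal; it is known to consist of a single point, with which it is identified. Running time counts elementary arithmetic operations and comparisons on numbers. *)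

theory Defs
  imports Complex_Main "HOL-Library.FuncSet" "HOL-Library.Multiset" "HOL-Library.Landau_Symbols"
begin

section \<open>Games and the nucleolus\<close>

definition efficient :: "'a set \<Rightarrow> ('a set \<Rightarrow> real) \<Rightarrow> ('a \<Rightarrow> real) set" where
  "efficient N v = {x \<in> N \<rightarrow>\<^sub>E UNIV. (\<Sum>i\<in>N. x i) = v N}"

definition excess :: "('a set \<Rightarrow> real) \<Rightarrow> ('a \<Rightarrow> real) \<Rightarrow> 'a set \<Rightarrow> real" where
  "excess v x S = (\<Sum>i\<in>S. x i) - v S"

definition excess_vector :: "'a set \<Rightarrow> ('a set \<Rightarrow> real) \<Rightarrow> ('a \<Rightarrow> real) \<Rightarrow> real list" where
  "excess_vector N v x = sorted_list_of_multiset (image_mset (excess v x) (mset_set (Pow N)))"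

text \<open>All excess vectors have length \<open>2 ^ card N\<close>, so \<^const>\<open>lex\<close> is the strict lexicographic
  order on them; it is total, hence ``no larger vector'' is maximality.\<close>

definition nucleolus :: "'a set \<Rightarrow> ('a set \<Rightarrow> real) \<Rightarrow> ('a \<Rightarrow> real) set" where
  "nucleolus N v = {x \<in> efficient N v. \<forall>y \<in> efficient N v.
     (excess_vector N v x, excess_vector N v y) \<notin> lex {(a, b). a < b}}"

text \<open>The value function of the single market uncapacitated production-distribution game with
  unit profits \<open>\<alpha>\<close> and demands \<open>d\<close>.\<close>

definition pd_value :: "('a \<Rightarrow> real) \<Rightarrow> ('a \<Rightarrow> real) \<Rightarrow> 'a set \<Rightarrow> real" where
  "pd_value \<alpha> d S = (if S = {} then 0 else (\<Sum>i\<in>S. d i) * Max (\<alpha> ` S))"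


section \<open>Algorithms on real numbers and their running time\<close>

text \<open>
  A structured real random access machine. Memory consists of arrays of natural numbers (sizes,
  counters, indices) and arrays of real numbers; a program mentions arrays by literal names, so it
  uses finitely many of them, but cells are addressed indirectly. Scalars are cell 0 of an array.

  Real numbers admit the four arithmetic operations and comparison only. There is no rounding and
  no conversion from reals to indices, and real constants are restricted to integers, so that a
  program cannot carry hidden information in a constant. Index arithmetic is restricted to addition
  and truncated subtraction. Division by zero returns 0, which a program can prevent by a test.
\<close>

record state =
  idx :: "nat \<Rightarrow> nat \<Rightarrow> nat"
  num :: "nat \<Rightarrow> nat \<Rightarrow> real"

datatype iexp =
    IConst nat
  | ICell nat iexp
  | IAdd iexp iexp
  | ISub iexp iexp

datatype rexp =
    RConst int
  | RCell nat iexp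
  | RAdd rexp rexp
  | RSub rexp rexp
  | RMul rexp rexp
  | RDiv rexp rexp

datatype bexp =
    ILess iexp iexp
  | RLess rexp rexp
  | Neg bexp
  | Conj bexp bexp

datatype com =
    Skip
  | IAssign nat iexp iexp
  | RAssign nat iexp rexp
  | Seq com com
  | Cond bexp com com
  | While bexp com

primrec ival :: "iexp \<Rightarrow> state \<Rightarrow> nat" where
  "ival (IConst k) s = k"
| "ival (ICell a e) s = idx s a (ival e s)"
| "ival (IAdd e f) s = ival e s + ival f s"
| "ival (ISub e f) s = ival e s - ival f s"

primrec rval :: "rexp \<Rightarrow> state \<Rightarrow> real" where
  "rval (RConst k) s = of_int k"
| "rval (RCell a e) s = num s a (ival e s)"
| "rval (RAdd e f) s = rval e s + rval f s"
| "rval (RSub e f) s = rval e s - rval f s"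
| "rval (RMul e f) s = rval e s * rval f s"
| "rval (RDiv e f) s = rval e s / rval f s"

primrec bval :: "bexp \<Rightarrow> state \<Rightarrow> bool" where
  "bval (ILess e f) s = (ival e s < ival f s)"
| "bval (RLess e f) s = (rval e s < rval f s)"
| "bval (Neg b) s = (\<not> bval b s)"
| "bval (Conj b c) s = (bval b s \<and> bval c s)"

text \<open>
  Every step is charged: each arithmetic operation, comparison, connective, constant and memory
  access, on reals as well as on indices, and each command executed. This dominates the number of
  elementary arithmetic operations and comparisons on numbers.
\<close>

primrec icost :: "iexp \<Rightarrow> nat" where
  "icost (IConst k) = 1"
| "icost (ICell a e) = 1 + icost e"
| "icost (IAdd e f) = 1 + icost e + icost f"
| "icost (ISub e f) = 1 + icost e + icost f"

primrec rcost :: "rexp \<Rightarrow> nat" where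
  "rcost (RConst k) = 1"
| "rcost (RCell a e) = 1 + icost e"
| "rcost (RAdd e f) = 1 + rcost e + rcost f"
| "rcost (RSub e f) = 1 + rcost e + rcost f"
| "rcost (RMul e f) = 1 + rcost e + rcost f"
| "rcost (RDiv e f) = 1 + rcost e + rcost f"

primrec bcost :: "bexp \<Rightarrow> nat" where
  "bcost (ILess e f) = 1 + icost e + icost f"
| "bcost (RLess e f) = 1 + rcost e + rcost f"
| "bcost (Neg b) = 1 + bcost b"
| "bcost (Conj b c) = 1 + bcost b + bcost c"

definition set_cell :: "(nat \<Rightarrow> nat \<Rightarrow> 'b) \<Rightarrow> nat \<Rightarrow> nat \<Rightarrow> 'b \<Rightarrow> nat \<Rightarrow> nat \<Rightarrow> 'b" where
  "set_cell m a i w = m(a := (m a)(i := w))"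

text \<open>\<open>exec c s t s'\<close>: started in \<open>s\<close>, the program \<open>c\<close> halts after \<open>t\<close> steps in \<open>s'\<close>.\<close>

inductive exec :: "com \<Rightarrow> state \<Rightarrow> nat \<Rightarrow> state \<Rightarrow> bool" where
  Skip: "exec Skip s 1 s"
| IAssign: "exec (IAssign a e f) s (1 + icost e + icost f)
    (s\<lparr>idx := set_cell (idx s) a (ival e s) (ival f s)\<rparr>)"
| RAssign: "exec (RAssign a e f) s (1 + icost e + rcost f)
    (s\<lparr>num := set_cell (num s) a (ival e s) (rval f s)\<rparr>)"
| Seq: "exec c s t s' \<Longrightarrow> exec c' s' t' s'' \<Longrightarrow> exec (Seq c c') s (1 + t + t') s''"
| CondTrue: "bval b s \<Longrightarrow> exec c s t s' \<Longrightarrow> exec (Cond b c c') s (1 + bcost b + t) s'"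
| CondFalse: "\<not> bval b s \<Longrightarrow> exec c' s t s' \<Longrightarrow> exec (Cond b c c') s (1 + bcost b + t) s'"
| WhileFalse: "\<not> bval b s \<Longrightarrow> exec (While b c) s (1 + bcost b) s"
| WhileTrue: "bval b s \<Longrightarrow> exec c s t s' \<Longrightarrow> exec (While b c) s' t' s''
    \<Longrightarrow> exec (While b c) s (1 + bcost b + t + t') s''"

lemma exec_deterministic:
  assumes "exec c s t s'" "exec c s u s''"
  shows "t = u \<and> s' = s''"
  using assms
proof (induction arbitrary: u s'' rule: exec.induct)
  case (Seq c s t s' c' t' s1)
  from Seq.prems Seq.IH show ?case by (cases rule: exec.cases) blast+
next
  case (CondTrue b s c t s' c')
  from CondTrue.prems CondTrue.IH CondTrue.hyps show ?case by (cases rule: exec.cases) blast+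
next
  case (CondFalse b s c' t s' c)
  from CondFalse.prems CondFalse.IH CondFalse.hyps show ?case by (cases rule: exec.cases) blast+
next
  case (WhileTrue b s c t s' t' s1)
  from WhileTrue.prems WhileTrue.IH WhileTrue.hyps show ?case by (cases rule: exec.cases) blast+
qed (auto elim: exec.cases)

text \<open>The number of players is cell 0 of index array 0. Players are numbered \<open>1, \<dots>, n\<close>: the profit,
  demand and resulting payoff of player \<open>i\<close> are cell \<open>i\<close> of real arrays 0, 1 and 2. All remaining
  memory is initially zero.\<close>

definition pd_input :: "nat \<Rightarrow> (nat \<Rightarrow> real) \<Rightarrow> (nat \<Rightarrow> real) \<Rightarrow> state" where
  "pd_input n \<alpha> d = \<lparr>
     idx = set_cell (\<lambda>a i. 0) 0 0 n,
     num = (\<lambda>a i. if i \<in> {1..n} \<and> a = 0 then \<alpha> i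
                  else if i \<in> {1..n} \<and> a = 1 then d i else 0)\<rparr>"

definition pd_output :: "nat \<Rightarrow> state \<Rightarrow> nat \<Rightarrow> real" where
  "pd_output n s = restrict (num s 2) {1..n}"

end

theory Submission
  imports Defs "HOL-Real_Asymp.Real_Asymp"
begin

text \<open>Let \<open>p\<close> be a player of maximal profit and \<open>y\<^sub>i = \<alpha>\<^sub>p d\<^sub>i - x\<^sub>i\<close> the concession of
  player \<open>i \<noteq> p\<close> to \<open>p\<close>. A coalition \<open>T\<close> with \<open>p \<notin> T\<close> has excess \<open>margin T - y(T)\<close>, where
  \<open>margin T = (\<alpha>\<^sub>p - max\<^sub>T \<alpha>) d(T)\<close>, and one with \<open>p \<in> T\<close> has excess \<open>y(N - T)\<close>. Hence the
  nucleolus is reached by water filling: raise all concessions at a common level \<open>t\<close> until some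
  coalition without \<open>p\<close> has excess \<open>t\<close>. Its members cannot concede more without making that
  excess the smaller one, nor less without lowering their own concession, so one of them is settled
  at level \<open>t\<close> and the rest of the water keeps rising.

  With the settled set \<open>F\<close> and a member \<open>k\<close> of maximal profit fixed, the coalition which stops the
  water consists of \<open>k\<close>, the settled players with \<open>(\<alpha>\<^sub>p - \<alpha>\<^sub>k) d\<^sub>i < y\<^sub>i\<close> and an initial segment of
  the unsettled ones in the order of demands. Each of the \<open>n\<close> rounds thus inspects \<open>O(n\<^sup>2)\<close>
  coalitions at linear cost.\<close>

section \<open>A criterion for the nucleolus\<close>

text \<open>Both lists begin with the common entries below \<open>r\<close>, followed by
  \<open>count B r\<close> copies of \<open>r\<close>. At the next position \<open>A\<close> still
  has an \<open>r\<close>, while \<open>B\<close> has moved on to a larger entry, which exists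
  because the sizes agree.\<close>

lemma sorted_list_of_multiset_lex:
  fixes A B :: "'a::linorder multiset"
  assumes size: "size A = size B" and less: "\<And>u. u < r \<Longrightarrow> count A u = count B u"
    and more: "count B r < count A r"
  shows "(sorted_list_of_multiset A, sorted_list_of_multiset B) \<in> lex {(a, b). a < b}"
proof -
  have split: "sorted_list_of_multiset C = sorted_list_of_multiset (filter_mset (\<lambda>u. u < r) C)
      @ replicate (count C r) r @ sorted_list_of_multiset (filter_mset (\<lambda>u. r < u) C)"
    (is "_ = ?L @ ?R @ ?H") for C
  proof (rule properties_for_sort[symmetric, of "?L @ ?R @ ?H" "sorted_list_of_multiset C", simplified sorted_sort_id sorted_sorted_list_of_multiset, THEN sym])
    show "mset (?L @ ?R @ ?H) = mset (sorted_list_of_multiset C)"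
      by (rule multiset_eqI) (auto simp: count_replicate_mset)
    show "sorted (?L @ ?R @ ?H)"
      by (auto simp: sorted_append)
  qed
  let ?L = "sorted_list_of_multiset (filter_mset (\<lambda>u. u < r) A)"
  have L: "filter_mset (\<lambda>u. u < r) B = filter_mset (\<lambda>u. u < r) A"
    by (rule multiset_eqI) (auto simp: less)
  obtain m where m: "count A r = count B r + Suc m"
    using more less_iff_Suc_add[of "count B r" "count A r"] by auto
  define H where "H = sorted_list_of_multiset (filter_mset (\<lambda>u. r < u) B)"
  have len: "length (sorted_list_of_multiset A) = length (sorted_list_of_multiset B)"
    using size by (metis mset_sorted_list_of_multiset size_mset)
  have "H \<noteq> []"
    using len unfolding split[of A] split[of B] L H_def[symmetric] m by auto
  then obtain h H' where H: "H = h # H'"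
    by (cases H) auto
  have "h \<in> set H" by (simp add: H)
  then have "r < h" unfolding H_def by simp
  have "sorted_list_of_multiset A = (?L @ replicate (count B r) r) @ r # (replicate m r
      @ sorted_list_of_multiset (filter_mset (\<lambda>u. r < u) A))"
    by (subst split[of A]) (simp add: m replicate_add replicate_app_Cons_same)
  moreover have "sorted_list_of_multiset B = (?L @ replicate (count B r) r) @ h # H'"
    by (subst split[of B]) (simp add: L flip: H H_def)
  ultimately show ?thesis
    unfolding lex_conv using len \<open>r < h\<close> by blast
qed

text \<open>Only coalitions whose excess changes matter. Let \<open>r\<close> be the least excess
  that \<open>z\<close> gives to one of them; \<open>x\<close> gives all of them more than
  \<open>r\<close>. Hence the two multisets coincide below \<open>r\<close>, and \<open>r\<close>
  itself occurs more often for \<open>z\<close>.\<close>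

lemma excess_vector_lex:
  assumes "finite N" and "S \<subseteq> N" and "excess v z S \<noteq> excess v x S"
    and sep: "\<And>T. T \<subseteq> N \<Longrightarrow> excess v z T \<noteq> excess v x T \<Longrightarrow> excess v z S < excess v x T"
  shows "(excess_vector N v z, excess_vector N v x) \<in> lex {(a, b). a < b}"
proof -
  let ?D = "{T. T \<subseteq> N \<and> excess v z T \<noteq> excess v x T}"
  define r where "r = Min (excess v z ` ?D)"
  have fin: "finite (Pow N)" "finite ?D" using \<open>finite N\<close> by auto
  have "r \<in> excess v z ` ?D"
    unfolding r_def using assms fin by (intro Min_in) auto
  then obtain T0 where T0: "T0 \<subseteq> N" "excess v z T0 \<noteq> excess v x T0" "excess v z T0 = r" by auto
  have rz: "r \<le> excess v z T" if "T \<subseteq> N" "excess v z T \<noteq> excess v x T" for T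
    unfolding r_def using that fin by (intro Min_le) auto
  have rx: "r < excess v x T" if "T \<subseteq> N" "excess v z T \<noteq> excess v x T" for T
    using rz[OF assms(2,3)] sep[OF that] by simp
  have cnt: "count (image_mset (excess v w) (mset_set (Pow N))) u
      = card {T. T \<subseteq> N \<and> excess v w T = u}" for w u
    using fin by (simp add: count_image_mset' sum_mset_sum_list flip: card_eq_sum)
      (metis (no_types, lifting) Collect_cong)
  show ?thesis
    unfolding excess_vector_def
  proof (rule sorted_list_of_multiset_lex[where r = r])
    fix u assume "u < r"
    have "excess v z T = u \<longleftrightarrow> excess v x T = u" if "T \<subseteq> N" for T
      using rz[OF that] rx[OF that] \<open>u < r\<close> by (cases "excess v z T = excess v x T") auto
    then have "{T. T \<subseteq> N \<and> excess v z T = u} = {T. T \<subseteq> N \<and> excess v x T = u}"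
      by blast
    then show "count (image_mset (excess v z) (mset_set (Pow N))) u
        = count (image_mset (excess v x) (mset_set (Pow N))) u"
      by (simp add: cnt)
  next
    have "excess v z T = r" if "T \<subseteq> N" "excess v x T = r" for T
      using rx[OF that(1)] that(2) by (cases "excess v z T = excess v x T") auto
    then have "{T. T \<subseteq> N \<and> excess v x T = r} \<subseteq> {T. T \<subseteq> N \<and> excess v z T = r}"
      by auto
    moreover have "T0 \<in> {T. T \<subseteq> N \<and> excess v z T = r} - {T. T \<subseteq> N \<and> excess v x T = r}"
      using T0 by auto
    ultimately have "{T. T \<subseteq> N \<and> excess v x T = r} \<subset> {T. T \<subseteq> N \<and> excess v z T = r}"
      by (metis DiffE psubsetI)
    then show "count (image_mset (excess v x) (mset_set (Pow N))) r
        < count (image_mset (excess v z) (mset_set (Pow N))) r"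
      unfolding cnt using \<open>finite N\<close> by (intro psubset_card_mono) auto
  qed simp
qed

text \<open>Strict defeat of every competitor gives uniqueness and, by asymmetry of the
  lexicographic order, also maximality.\<close>

lemma nucleolus_eqI:
  assumes x: "x \<in> efficient N v"
    and worse: "\<And>z. z \<in> efficient N v \<Longrightarrow> z \<noteq> x \<Longrightarrow>
      (excess_vector N v z, excess_vector N v x) \<in> lex {(a, b). a < b}"
  shows "nucleolus N v = {x}"
proof -
  have "asym (lex {(a, b). a < (b::real)})"
    by (intro asym_lex asymI) auto
  then have "(excess_vector N v x, excess_vector N v z) \<notin> lex {(a, b). a < b}"
    if "z \<in> efficient N v" for z
    using worse[OF that] by (cases "z = x") (auto dest: asymD)
  then show ?thesis
    using x worse unfolding nucleolus_def by blast
qed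

section \<open>Equitable concessions\<close>

locale pd_game =
  fixes N :: "'a set" and \<alpha> d :: "'a \<Rightarrow> real" and p :: 'a
  assumes fin: "finite N" and pN: "p \<in> N"
    and top: "\<And>i. i \<in> N \<Longrightarrow> \<alpha> i \<le> \<alpha> p" and d_nonneg: "\<And>i. i \<in> N \<Longrightarrow> 0 \<le> d i"
begin

section \<open>Excesses in terms of concessions\<close>

definition margin :: "'a set \<Rightarrow> real" where
  "margin T = (\<alpha> p - Max (\<alpha> ` T)) * sum d T"

text \<open>A change of coordinates: \<open>p\<close> collects what the others concede, so
  efficiency is automatic and the concessions are free variables.\<close>

definition payoff :: "('a \<Rightarrow> real) \<Rightarrow> 'a \<Rightarrow> real" where
  "payoff y = (\<lambda>i\<in>N. if i = p then \<alpha> p * d p + sum y (N - {p}) else \<alpha> p * d i - y i)"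

lemma Max_top: "p \<in> T \<Longrightarrow> T \<subseteq> N \<Longrightarrow> Max (\<alpha> ` T) = \<alpha> p"
  using fin top by (intro Max_eqI) (auto intro: finite_subset)

lemma excess_without_top:
  assumes "T \<subseteq> N - {p}" and "T \<noteq> {}"
  shows "excess (pd_value \<alpha> d) (payoff y) T = margin T - sum y T"
proof -
  have "sum (payoff y) T = (\<Sum>i\<in>T. \<alpha> p * d i - y i)"
    using assms by (intro sum.cong) (auto simp: payoff_def)
  then show ?thesis
    using assms unfolding excess_def pd_value_def margin_def
    by (simp add: sum_subtractf sum_distrib_left algebra_simps)
qed

text \<open>Concessions made inside \<open>T\<close> cancel against what \<open>p\<close> collects;
  those of the outsiders remain as the surplus of \<open>T\<close>.\<close>

lemma excess_with_top:
  assumes "T \<subseteq> N" and "p \<in> T"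
  shows "excess (pd_value \<alpha> d) (payoff y) T = sum y (N - T)"
proof -
  have T: "T = insert p (T - {p})" and finT: "finite (T - {p})"
    using assms fin by (auto intro: finite_subset)
  have *: "sum g T = g p + sum g (T - {p})" for g :: "'a \<Rightarrow> real"
    using T finT by (metis sum.insert Diff_iff singletonI)
  have "sum (payoff y) (T - {p}) = (\<Sum>i\<in>T - {p}. \<alpha> p * d i - y i)"
    using assms by (intro sum.cong) (auto simp: payoff_def)
  moreover have "sum y (N - {p}) = sum y (N - T) + sum y (T - {p})"
    using assms fin by (subst sum.union_disjoint[symmetric])
      (auto intro: sum.cong finite_subset simp: Un_Diff_cancel2 intro!: arg_cong2[where f = sum])
  ultimately show ?thesis
    using assms pN unfolding excess_def pd_value_def
    by (auto simp: Max_top * payoff_def sum_subtractf sum_distrib_left algebra_simps)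
qed

lemma payoff_efficient: "payoff y \<in> efficient N (pd_value \<alpha> d)"
  using excess_with_top[OF order_refl pN, of y] unfolding efficient_def excess_def
  by (simp add: payoff_def)

text \<open>Together with \<open>payoff_efficient\<close> this lets every competitor of the
  nucleolus be described by concessions as well.\<close>

lemma efficient_payoff:
  assumes "z \<in> efficient N (pd_value \<alpha> d)"
  shows "z = payoff (\<lambda>i. \<alpha> p * d i - z i)"
proof -
  have z: "z \<in> extensional N" "sum z N = \<alpha> p * sum d N"
    using assms pN by (auto simp: efficient_def pd_value_def Max_top PiE_def)
  have "\<alpha> p * sum d N = \<alpha> p * d p + \<alpha> p * sum d (N - {p})"
    unfolding sum.remove[OF fin pN, of d] by (rule distrib_left)
  then have zp: "z p = \<alpha> p * d p + (\<Sum>i\<in>N - {p}. \<alpha> p * d i - z i)"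
    using z(2) sum.remove[OF fin pN, of z]
    unfolding sum_subtractf sum_distrib_left[symmetric] by linarith
  show ?thesis
  proof
    fix i
    show "z i = payoff (\<lambda>i. \<alpha> p * d i - z i) i"
    proof (cases "i \<in> N")
      case True
      then show ?thesis unfolding payoff_def using zp by (cases "i = p") simp_all
    next
      case False
      then show ?thesis using z(1) by (simp add: payoff_def extensional_def)
    qed
  qed
qed

text \<open>With \<open>margin_attained\<close>, the margin is the minimum over members
  \<open>k\<close> of an expression additive in the players; this is why \<open>k\<close> is fixed
  first in the search.\<close>

lemma margin_le: "T \<subseteq> N \<Longrightarrow> k \<in> T \<Longrightarrow> margin T \<le> (\<alpha> p - \<alpha> k) * sum d T"
  unfolding margin_def using fin d_nonneg
  by (intro mult_right_mono diff_left_mono Max_ge sum_nonneg) (auto intro: finite_subset)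

lemma margin_attained:
  assumes "T \<subseteq> N" and "T \<noteq> {}"
  obtains k where "k \<in> T" and "margin T = (\<alpha> p - \<alpha> k) * sum d T"
proof -
  have "Max (\<alpha> ` T) \<in> \<alpha> ` T"
    using assms fin by (intro Max_in) (auto intro: finite_subset)
  then show ?thesis using that by (auto simp: margin_def)
qed

text \<open>By the second condition, the excess of \<open>S\<close> in the third one is in fact equal to \<open>y i\<close>, which
  is the largest concession in \<open>S\<close>.\<close>

definition equitable :: "('a \<Rightarrow> real) \<Rightarrow> 'a set \<Rightarrow> bool" where
  "equitable y F \<longleftrightarrow> (\<forall>i\<in>N - {p}. 0 \<le> y i)
     \<and> (\<forall>T\<subseteq>N - {p}. \<forall>i\<in>T. y i \<le> margin T - sum y T)
     \<and> (\<forall>i\<in>F. \<exists>S\<subseteq>N - {p}. i \<in> S \<and> margin S - sum y S \<le> y i)"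

text \<open>The start of water filling: at level 0 with nobody settled, the second condition only
  asks for non-negative margins.\<close>

lemma equitable_zero: "equitable (\<lambda>i. 0) {}"
proof -
  have "0 \<le> margin T" if "T \<subseteq> N - {p}" "i \<in> T" for T i
  proof -
    have "T \<subseteq> N" "T \<noteq> {}" using that by auto
    then obtain k where "k \<in> T" "margin T = (\<alpha> p - \<alpha> k) * sum d T"
      by (rule margin_attained)
    then show ?thesis
      using that top d_nonneg by (auto intro!: mult_nonneg_nonneg sum_nonneg)
  qed
  then show ?thesis by (auto simp: equitable_def)
qed

text \<open>Given a competitor \<open>z\<close>, let \<open>i\<close> have the least
  \<open>y i\<close> among the players whose concession changes. All coalitions whose excess changes
  have excess at least \<open>y i\<close> under \<open>y\<close>, and one of them falls below
  \<open>y i\<close> under \<open>z\<close>, so \<open>excess_vector_lex\<close> applies.\<close>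

theorem nucleolus_equitable:
  assumes "equitable y (N - {p})"
  shows "nucleolus N (pd_value \<alpha> d) = {payoff y}"
proof (rule nucleolus_eqI[OF payoff_efficient])
  let ?M = "N - {p}" and ?e = "\<lambda>y. excess (pd_value \<alpha> d) (payoff y)"
  have C0: "0 \<le> y j" if "j \<in> ?M" for j
    using assms that unfolding equitable_def by blast
  have C1: "y j \<le> margin T - sum y T" if "T \<subseteq> ?M" "j \<in> T" for T j
    using assms that unfolding equitable_def by blast
  have C2: "\<exists>S\<subseteq>?M. j \<in> S \<and> margin S - sum y S \<le> y j" if "j \<in> ?M" for j
    using assms that unfolding equitable_def by blast
  fix z' assume z': "z' \<in> efficient N (pd_value \<alpha> d)" "z' \<noteq> payoff y"
  define z where "z = (\<lambda>i. \<alpha> p * d i - z' i)"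
  have z: "z' = payoff z" unfolding z_def by (rule efficient_payoff) fact
  let ?D = "{i \<in> ?M. z i \<noteq> y i}"
  have "?D \<noteq> {}"
  proof
    assume "?D = {}"
    then have "payoff z = payoff y"
      by (auto simp: payoff_def fun_eq_iff restrict_def intro!: sum.cong)
    then show False using z z' by simp
  qed
  then obtain i where i: "i \<in> ?D" and least: "\<And>j. j \<in> ?D \<Longrightarrow> y i \<le> y j"
    using ex_is_arg_min_if_finite[of ?D y] fin by (auto simp: is_arg_min_linorder)
  obtain S where S: "S \<subseteq> ?M" "i \<in> S" "margin S - sum y S \<le> y i"
    using C2[of i] i by auto
  have finS: "finite S" using S fin by (auto intro: finite_subset)
  have yS: "y j \<le> y i" if "j \<in> S" for j
    using C1[OF S(1) that] S(3) by linarith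
  \<comment> \<open>Leaving out \<open>j\<close> alone makes the excess equal to the concession of
    \<open>j\<close>; these coalitions detect lowered concessions.\<close>
  have single: "?e w (N - {j}) = w j" if "j \<in> ?M" for j w
    using that pN excess_with_top[of "N - {j}" w] by (auto simp: double_diff)
  have eS: "?e w S = margin S - sum w S" for w
    using S by (intro excess_without_top) auto
  \<comment> \<open>A changed excess needs a changed concession, of an outsider if \<open>p\<close>
    is in \<open>T\<close> and of a member otherwise. That concession is at least \<open>y i\<close>
    and bounds the excess from below.\<close>
  have high: "y i \<le> ?e y T" if T: "T \<subseteq> N" "?e z T \<noteq> ?e y T" for T
  proof (cases "p \<in> T")
    case True
    then have "sum z (N - T) \<noteq> sum y (N - T)"
      using T excess_with_top by auto
    then obtain j where j: "j \<in> N - T" "z j \<noteq> y j" by (meson sum.cong)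
    have "y i \<le> y j" using j True by (intro least) auto
    also have "\<dots> \<le> sum y (N - T)"
      using j C0 True fin by (intro member_le_sum) auto
    finally show ?thesis using T True excess_with_top by auto
  next
    case False
    have "T \<noteq> {}" using T by (auto simp: excess_def)
    then have e: "?e w T = margin T - sum w T" for w
      using T False by (intro excess_without_top) auto
    then have "sum z T \<noteq> sum y T" using T by auto
    then obtain j where j: "j \<in> T" "z j \<noteq> y j" by (meson sum.cong)
    have "y i \<le> y j" using j False T by (intro least) auto
    also have "\<dots> \<le> ?e y T" using C1[of T j] T False j by (auto simp: e)
    finally show ?thesis .
  qed
  \<comment> \<open>Otherwise \<open>S\<close>, whose excess under \<open>y\<close> is exactly
    \<open>y i\<close>, does not get worse, so \<open>z\<close> takes no more from \<open>S\<close>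
    in total. But the changed members of \<open>S\<close> all concede exactly \<open>y i\<close>
    under \<open>y\<close>, and the coalitions \<open>N - {j}\<close> keep them from conceding less
    under \<open>z\<close>; as \<open>i\<close> changes, the total on \<open>S\<close> strictly
    grows.\<close>
  have "\<exists>U\<subseteq>N. ?e z U < y i \<and> y i \<le> ?e y U"
  proof (rule ccontr)
    assume no: "\<not> ?thesis"
    have *: "y i \<le> ?e z U" if "U \<subseteq> N" "y i \<le> ?e y U" for U
      using no that by (meson not_less)
    have "y i \<le> ?e y S" using C1[OF S(1,2)] by (simp add: eS)
    then have sumle: "sum z S \<le> sum y S" using *[of S] S unfolding eS by auto
    have le: "y j \<le> z j" if "j \<in> S" for j
    proof (cases "z j = y j")
      case False
      have jM: "j \<in> ?M" using that S by auto
      then have "j \<in> ?D" using False by simp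
      then have "y j = y i" using least yS[OF that] by (simp add: order_antisym)
      then have "y i \<le> ?e y (N - {j})" using single[OF jM, of y] by simp
      then have "y i \<le> ?e z (N - {j})" by (intro *) auto
      then show ?thesis using \<open>y j = y i\<close> single[OF jM, of z] by simp
    qed simp
    have "sum y S < sum z S"
      using finS le i S by (intro sum_strict_mono_ex1) (auto intro!: bexI[of _ i] simp: less_le)
    then show False using sumle by simp
  qed
  then obtain U where "U \<subseteq> N" "?e z U < y i" "y i \<le> ?e y U" by auto
  then show "(excess_vector N (pd_value \<alpha> d) z', excess_vector N (pd_value \<alpha> d) (payoff y))
      \<in> lex {(a, b). a < b}"
    unfolding z using fin high by (intro excess_vector_lex[of N U]) (auto intro: less_le_trans)
qed

end

section \<open>One step of water filling\<close>

text \<open>Ties in demand are broken by index, so initial segments are unambiguous. Reals are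
  compared by \<open><\<close> only, as in the machine test \<open>selected\<close>. If
  \<open>d 0 = 0\<close>, no player with positive index and non-negative demand comes before index
  0.\<close>

definition before :: "(nat \<Rightarrow> real) \<Rightarrow> nat \<Rightarrow> nat \<Rightarrow> bool" where
  "before d i j \<longleftrightarrow> d i < d j \<or> \<not> d j < d i \<and> i \<le> j"

lemma before_antisym: "before d i j \<Longrightarrow> before d j i \<Longrightarrow> i = j"
  unfolding before_def by linarith

lemma before_last:
  assumes "finite U" and "U \<noteq> {}"
  shows "\<exists>j\<in>U. \<forall>i\<in>U. before d i j"
  using assms
proof (induction rule: finite_ne_induct)
  case (insert x F)
  then obtain j where j: "j \<in> F" "\<forall>i\<in>F. before d i j" by blast
  show ?case
  proof (cases "before d x j")
    case False
    then have "before d i x" if "i = x \<or> i \<in> F" for i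
      using that j(2) unfolding before_def by force
    then show ?thesis by blast
  qed (use j in auto)
qed (simp add: before_def)

lemma before_first:
  assumes "finite U" and "U \<noteq> {}"
  shows "\<exists>j\<in>U. \<forall>i\<in>U. before d j i"
  using assms
proof (induction rule: finite_ne_induct)
  case (insert x F)
  then obtain j where j: "j \<in> F" "\<forall>i\<in>F. before d j i" by blast
  show ?case
  proof (cases "before d j x")
    case False
    then have "before d x i" if "i = x \<or> i \<in> F" for i
      using that j(2) unfolding before_def by force
    then show ?thesis by blast
  qed (use j in auto)
qed (simp add: before_def)

text \<open>Index 0 stands for no player: its initial segment is empty, which makes \<open>k\<close> together with
  settled players a candidate as well.\<close>

locale pd_nat = pd_game N \<alpha> d p for N :: "nat set" and \<alpha> d p +
  assumes zero: "0 \<notin> N" "d 0 = 0"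
begin

definition cand :: "nat set \<Rightarrow> (nat \<Rightarrow> real) \<Rightarrow> nat \<Rightarrow> nat \<Rightarrow> nat set" where
  "cand F y k j = {i \<in> N - {p}. i = k \<or> (\<alpha> p - \<alpha> k) * d i < y i \<or> i \<notin> F \<and> before d i j}"

text \<open>For \<open>k\<close> in \<open>S\<close> and \<open>y\<close> zero outside
  \<open>F\<close>, this bounds the excess of \<open>S\<close> while the unsettled concede nothing.
  Once they concede \<open>r\<close> each, the bound is
  \<open>cost y k S - r * card (S - F)\<close>. It equals \<open>r\<close> exactly if
  \<open>r\<close> is \<open>cost y k S\<close> divided by \<open>card (S - F) + 1\<close>, the
  water level of \<open>S\<close>.\<close>

definition cost :: "(nat \<Rightarrow> real) \<Rightarrow> nat \<Rightarrow> nat set \<Rightarrow> real" where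
  "cost y k S = (\<Sum>i\<in>S. (\<alpha> p - \<alpha> k) * d i - y i)"

text \<open>For fixed \<open>k\<close> the claim bounds an additive weight from below, and a greedy
  choice minimises it: the settled players of negative weight and an initial segment of the
  unsettled ones, whose weight does not decrease with demand. Which segment is needed depends on the
  signs of the weights and on whether \<open>k\<close> is settled.\<close>

lemma candidates_suffice:
  assumes F: "F \<subseteq> N - {p}" and out: "\<And>i. i \<in> N - {p} - F \<Longrightarrow> y i = 0" and r: "0 \<le> r"
    and lower: "\<And>k j. k \<in> N - {p} \<Longrightarrow> j \<in> insert 0 N \<Longrightarrow> cand F y k j - F \<noteq> {} \<Longrightarrow>
      r * (real (card (cand F y k j - F)) + 1) \<le> cost y k (cand F y k j)"
    and T: "T \<subseteq> N - {p}" "\<not> T \<subseteq> F" and k: "k \<in> T"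
  shows "r * (real (card (T - F)) + 1) \<le> cost y k T"
proof -
  let ?M = "N - {p}" and ?C = "\<alpha> p - \<alpha> k"
  \<comment> \<open>The unsettled players pay \<open>r\<close> each in these weights, so the
    inequality for a coalition reads \<open>r \<le> sum w S\<close>.\<close>
  define w where "w i = ?C * d i - (if i \<in> F then y i else r)" for i
  have C: "0 \<le> ?C" using k T top by auto
  have kM: "k \<in> ?M" using k T by auto
  have finM: "finite S" if "S \<subseteq> ?M" for S using that fin by (auto intro: finite_subset)
  have split: "sum g S = sum g (S \<inter> F) + sum g (S - F)" if "S \<subseteq> ?M" for g :: "nat \<Rightarrow> real" and S
    by (rule sum.Int_Diff) (rule finM[OF that])
  have conv: "sum w S = cost y k S - r * card (S - F)" if S: "S \<subseteq> ?M" for S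
  proof -
    have "sum w (S \<inter> F) = (\<Sum>i\<in>S \<inter> F. ?C * d i - y i)"
      by (intro sum.cong) (auto simp: w_def)
    moreover have "sum w (S - F) = (\<Sum>i\<in>S - F. (?C * d i - y i) - r)"
      using S out by (intro sum.cong) (auto simp: w_def)
    ultimately show ?thesis
      unfolding cost_def split[OF S] by (simp add: sum_subtractf mult.commute)
  qed
  have candM: "cand F y k j \<subseteq> ?M" for j by (auto simp: cand_def)
  have low: "r \<le> sum w (cand F y k j)" if "j \<in> insert 0 N" "cand F y k j - F \<noteq> {}" for j
    using lower[OF kM that] conv[OF candM[of j]] by (simp add: algebra_simps)
  have exch: "sum w B \<le> sum w A" if AB: "A \<subseteq> ?M" "B \<subseteq> ?M"
    and "\<And>i. i \<in> B - A \<Longrightarrow> w i \<le> 0" "\<And>i. i \<in> A - B \<Longrightarrow> 0 \<le> w i" for A B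
  proof -
    have "sum w B = sum w (B \<inter> A) + sum w (B - A)" "sum w A = sum w (A \<inter> B) + sum w (A - B)"
      using AB by (auto intro!: sum.Int_Diff finM)
    moreover have "sum w (B - A) \<le> 0" "0 \<le> sum w (A - B)"
      using that by (auto intro: sum_nonpos sum_nonneg)
    ultimately show ?thesis by (simp add: Int_commute)
  qed
  have inF: "sum w (cand F y k j \<inter> F) \<le> sum w (T \<inter> F)" for j
    using k T by (intro exch) (auto simp: cand_def w_def)
  have out_nonneg: "\<not> ?C * d i < y i" if "i \<in> ?M - F" for i
    using that out C d_nonneg by (simp add: not_less)
  have mem: "i \<in> cand F y k j - F \<longleftrightarrow> i \<in> ?M - F \<and> (i = k \<or> before d i j)" for i j
    using out_nonneg[of i] by (auto simp: cand_def)
  \<comment> \<open>The unsettled players of non-positive weight form an initial segment. If there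
    are any, the last one gives the index \<open>j\<close>.\<close>
  define U where "U = {i \<in> ?M - F. ?C * d i \<le> r}"
  have "\<exists>j. j \<in> insert 0 N \<and> cand F y k j - F \<noteq> {} \<and>
      sum w (cand F y k j - F) \<le> sum w (T - F)"
  proof (cases "U = {}")
    case False
    moreover have "finite U" unfolding U_def by (intro finM) auto
    ultimately obtain j where j: "j \<in> U" "\<And>i. i \<in> U \<Longrightarrow> before d i j"
      using before_last[of U d] by blast
    have "i \<in> U" if "before d i j" "i \<in> ?M - F" for i
    proof -
      have "?C * d i \<le> ?C * d j"
        using that C by (intro mult_left_mono) (auto simp: before_def)
      then show ?thesis using that j by (auto simp: U_def)
    qed
    moreover have "U \<subseteq> ?M - F" by (auto simp: U_def)
    ultimately have "cand F y k j - F = U \<union> ({k} - F)"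
      unfolding set_eq_iff mem using j(2) kM by blast
    then have eq: "sum w (cand F y k j - F) = sum w (U \<union> ({k} - F))" by simp
    have "sum w (U \<union> ({k} - F)) \<le> sum w (T - F)"
      using k T kM by (intro exch) (auto simp: U_def w_def)
    then show ?thesis
      using eq j mem[of j j] by (intro exI[of _ j]) (auto simp: U_def before_def)
  next
    case True
    then have pos: "0 < w i" if "i \<in> ?M - F" for i
      using that by (force simp: U_def w_def)
    show ?thesis
    proof (cases "k \<in> F")
      \<comment> \<open>All unsettled weights are positive and \<open>k\<close> itself is unsettled:
        the empty segment of index 0 leaves \<open>k\<close> as the only unsettled member.\<close>
      case False
      have no: "\<not> before d i 0" if "i \<in> ?M - F" for i
        using that zero d_nonneg[of i] by (cases "i = 0") (auto simp: before_def)
      then have "cand F y k 0 - F = {k}"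
        unfolding set_eq_iff mem using kM False no by blast
      moreover have "sum w {k} \<le> sum w (T - F)"
        using k T False pos by (intro exch) (auto intro: less_imp_le)
      ultimately show ?thesis by (intro exI[of _ 0]) simp
    next
      \<comment> \<open>With \<open>k\<close> settled, some other unsettled player has to be taken,
        and the first in the order is the cheapest.\<close>
      case k: True
      have "finite (?M - F)" "?M - F \<noteq> {}" using T fin by auto
      then obtain j where j: "j \<in> ?M - F" "\<forall>i\<in>?M - F. before d j i"
        using before_first[of "?M - F" d] by auto
      have only: "i = j" if "i \<in> ?M - F" "before d i j" for i
        using that(2) bspec[OF j(2) that(1)] by (rule before_antisym)
      then have eq: "cand F y k j - F = {j}"
      proof (intro set_eqI iffI)
        fix i assume "i \<in> cand F y k j - F"
        then show "i \<in> {j}" using only k unfolding mem by blast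
      next
        fix i assume "i \<in> {j}"
        then show "i \<in> cand F y k j - F" using j(1) unfolding mem before_def by simp
      qed
      obtain i where i: "i \<in> T - F" using T by auto
      then have iM: "i \<in> ?M - F" using T(1) by blast
      then have "d j \<le> d i" using bspec[OF j(2) iM] unfolding before_def by linarith
      then have "?C * d j \<le> ?C * d i"
        using C by (rule mult_left_mono)
      then have "w j \<le> sum w {i}" using iM j(1) by (simp add: w_def)
      also have "\<dots> \<le> sum w (T - F)"
        using i T pos by (intro exch) (auto intro: less_imp_le)
      finally show ?thesis using eq j by (intro exI[of _ j]) auto
    qed
  qed
  then obtain j where j: "j \<in> insert 0 N" "cand F y k j - F \<noteq> {}"
    "sum w (cand F y k j - F) \<le> sum w (T - F)" by blast
  have "r \<le> sum w (cand F y k j)" by (rule low) fact+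
  also have "\<dots> \<le> sum w T"
    using inF[of j] j(3) split[OF candM, of w j] split[OF T(1), of w] by simp
  finally show ?thesis using conv[OF T(1)] by (simp add: algebra_simps)
qed

text \<open>Coalitions inside \<open>F\<close> keep their excess, all others retain at least
  \<open>r\<close> by \<open>candidates_suffice\<close>, and the tight coalition \<open>S\<close>
  certifies that \<open>e\<close> is stopped at \<open>r\<close>.\<close>

lemma equitable_raise:
  assumes F: "F \<subseteq> N - {p}" and out: "\<And>i. i \<in> N - {p} - F \<Longrightarrow> y i = 0"
    and eq: "equitable (\<lambda>i. if i \<in> F then y i else t) F"
    and t: "\<And>i. i \<in> F \<Longrightarrow> y i \<le> t"
    and lower: "\<And>k j. k \<in> N - {p} \<Longrightarrow> j \<in> insert 0 N \<Longrightarrow> cand F y k j - F \<noteq> {} \<Longrightarrow>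
      r * (real (card (cand F y k j - F)) + 1) \<le> cost y k (cand F y k j)"
    and S: "S \<subseteq> N - {p}" "k \<in> S" "e \<in> S - F"
      "r * (real (card (S - F)) + 1) = cost y k S"
  shows "equitable (\<lambda>i. if i \<in> insert e F then (y(e := r)) i else r) (insert e F) \<and> t \<le> r"
proof -
  let ?M = "N - {p}"
  let ?Y = "\<lambda>t i. if i \<in> F then y i else t"
  have E0: "0 \<le> ?Y t j" if "j \<in> ?M" for j
    using eq that unfolding equitable_def by blast
  have E1: "?Y t j \<le> margin T - sum (?Y t) T" if "T \<subseteq> ?M" "j \<in> T" for T j
    using eq that unfolding equitable_def by blast
  have E2: "\<exists>S\<subseteq>?M. j \<in> S \<and> margin S - sum (?Y t) S \<le> ?Y t j" if "j \<in> F" for j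
    using eq that unfolding equitable_def by blast
  have finM: "finite T" if "T \<subseteq> ?M" for T using that fin by (auto intro: finite_subset)
  have sumY: "sum (?Y u) T = sum y T + u * card (T - F)" if "T \<subseteq> ?M" for T u
  proof -
    have "sum (?Y u) (T \<inter> F) = sum y (T \<inter> F)" "sum y (T - F) = 0"
      using that out by (auto intro!: sum.cong sum.neutral)
    moreover have "sum (?Y u) (T - F) = sum (\<lambda>_. u) (T - F)" by (intro sum.cong) auto
    ultimately show ?thesis
      using sum.Int_Diff[OF finM[OF that], of y F] sum.Int_Diff[OF finM[OF that], of "?Y u" F]
      by (simp add: mult.commute)
  qed
  have cost_eq: "cost y k T = (\<alpha> p - \<alpha> k) * sum d T - sum y T" for k T
    by (simp add: cost_def sum_subtractf sum_distrib_left)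
  have e: "e \<in> ?M" "e \<notin> F" using S by auto
  \<comment> \<open>At level \<open>t\<close> the excess of \<open>S\<close> is still at least
    \<open>t\<close>, whereas level \<open>r\<close> makes its bound tight. Cancelling the positive
    factor \<open>card (S - F) + 1\<close> yields \<open>t \<le> r\<close>.\<close>
  have "t \<le> margin S - sum (?Y t) S" using E1[of S e] S by auto
  also have "\<dots> \<le> cost y k S - t * card (S - F)"
    using margin_le[of S k] S sumY[of S t] by (auto simp: cost_eq)
  also have "\<dots> = r * (real (card (S - F)) + 1) - t * card (S - F)" using S by simp
  finally have "t * (real (card (S - F)) + 1) \<le> r * (real (card (S - F)) + 1)"
    by (simp add: algebra_simps)
  then have tr: "t \<le> r" by (simp add: mult_le_cancel_right add_pos_nonneg)
  have t0: "0 \<le> t" using E0[of e] e by simp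
  have up: "r \<le> margin T - sum (?Y r) T" if T: "T \<subseteq> ?M" "\<not> T \<subseteq> F" for T
  proof -
    have "T \<subseteq> N" "T \<noteq> {}" using T by auto
    then obtain l where l: "l \<in> T" "margin T = (\<alpha> p - \<alpha> l) * sum d T"
      by (rule margin_attained)
    have "r * (real (card (T - F)) + 1) \<le> cost y l T"
    proof (rule candidates_suffice[OF F _ _ _ T l(1)])
      show "y i = 0" if "i \<in> ?M - F" for i using that by (rule out)
      show "0 \<le> r" using t0 tr by linarith
    qed (rule lower)
    then show ?thesis using l sumY[OF T(1)] by (simp add: cost_eq algebra_simps)
  qed
  have "equitable (?Y r) (insert e F)"
    unfolding equitable_def
  proof (intro conjI ballI allI impI)
    fix i assume "i \<in> ?M" then show "0 \<le> ?Y r i" using E0[of i] t0 tr by (auto split: if_splits)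
  next
    fix T i assume T: "T \<subseteq> ?M" "i \<in> T"
    show "?Y r i \<le> margin T - sum (?Y r) T"
    proof (cases "T \<subseteq> F")
      case True
      then have "sum (?Y r) T = sum (?Y t) T" by (intro sum.cong) auto
      moreover have "?Y t i \<le> margin T - sum (?Y t) T" using E1 T by blast
      moreover have "i \<in> F" using T True by blast
      ultimately show ?thesis by simp
    next
      case False
      have "?Y r i \<le> r" using t tr by force
      then show ?thesis using up[OF T(1) False] by linarith
    qed
  next
    fix i assume i: "i \<in> insert e F"
    show "\<exists>S\<subseteq>?M. i \<in> S \<and> margin S - sum (?Y r) S \<le> ?Y r i"
    proof (cases "i = e")
      case True
      have "S \<subseteq> N" using S by auto
      then have "margin S - sum (?Y r) S \<le> r"
        using margin_le[of S k] S sumY[of S r] by (simp add: cost_eq algebra_simps)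
      then show ?thesis using S True by auto
    next
      case False
      \<comment> \<open>Old certificates survive: raising the unsettled players only lowers the
        excess of \<open>S'\<close>, and the concession of \<open>i\<close> is fixed.\<close>
      then have iF: "i \<in> F" using i by simp
      then obtain S' where S': "S' \<subseteq> ?M" "i \<in> S'" "margin S' - sum (?Y t) S' \<le> ?Y t i"
        using E2 by blast
      moreover have "sum (?Y t) S' \<le> sum (?Y r) S'" using tr by (intro sum_mono) auto
      ultimately show ?thesis using iF by (intro exI[of _ S']) auto
    qed
  qed
  moreover have "?Y r = (\<lambda>i. if i \<in> insert e F then (y(e := r)) i else r)"
    using e by auto
  ultimately show ?thesis using tr by simp
qed

end

section \<open>Running times of programs\<close>

definition runs :: "com \<Rightarrow> state \<Rightarrow> nat \<Rightarrow> (state \<Rightarrow> bool) \<Rightarrow> bool" where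
  "runs c s B Q \<longleftrightarrow> (\<exists>t s'. exec c s t s' \<and> t \<le> B \<and> Q s')"

lemma runs_mono: "runs c s B Q \<Longrightarrow> (\<And>s'. Q s' \<Longrightarrow> Q' s') \<Longrightarrow> B \<le> B' \<Longrightarrow> runs c s B' Q'"
  unfolding runs_def by (meson order_trans)

lemma runs_Seq:
  assumes "runs c s B1 P" and "\<And>s'. P s' \<Longrightarrow> runs c' s' B2 Q" and "Suc (B1 + B2) \<le> B"
  shows "runs (Seq c c') s B Q"
proof -
  obtain t s' where 1: "exec c s t s'" "t \<le> B1" "P s'"
    using assms(1) by (auto simp: runs_def)
  obtain t' s'' where 2: "exec c' s' t' s''" "t' \<le> B2" "Q s''"
    using assms(2)[OF 1(3)] by (auto simp: runs_def)
  have "1 + t + t' \<le> B" using 1(2) 2(2) assms(3) by linarith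
  then show ?thesis unfolding runs_def using exec.Seq[OF 1(1) 2(1)] 2(3) by blast
qed

lemma runs_Cond:
  assumes "bval b s \<Longrightarrow> runs c s B1 Q" and "\<not> bval b s \<Longrightarrow> runs c' s B1 Q"
    and "Suc (bcost b + B1) \<le> B"
  shows "runs (Cond b c c') s B Q"
proof (cases "bval b s")
  case True
  then obtain t s' where 1: "exec c s t s'" "t \<le> B1" "Q s'"
    using assms(1) by (auto simp: runs_def)
  moreover have "1 + bcost b + t \<le> B" using 1(2) assms(3) by linarith
  ultimately show ?thesis unfolding runs_def using exec.CondTrue[OF True 1(1)] by blast
next
  case False
  then obtain t s' where 1: "exec c' s t s'" "t \<le> B1" "Q s'"
    using assms(2) by (auto simp: runs_def)
  moreover have "1 + bcost b + t \<le> B" using 1(2) assms(3) by linarith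
  ultimately show ?thesis unfolding runs_def using exec.CondFalse[OF False 1(1)] by blast
qed

section \<open>Loop-free programs as state transformers\<close>

primrec loop_free :: "com \<Rightarrow> bool" where
  "loop_free Skip = True"
| "loop_free (IAssign a e f) = True"
| "loop_free (RAssign a e f) = True"
| "loop_free (Seq c c') = (loop_free c \<and> loop_free c')"
| "loop_free (Cond b c c') = (loop_free c \<and> loop_free c')"
| "loop_free (While b c) = False"

text \<open>The \<open>While\<close> equations here and in \<open>ccost\<close> are placeholders,
  excluded by \<open>loop_free\<close>.\<close>

primrec step :: "com \<Rightarrow> state \<Rightarrow> state" where
  "step Skip s = s"
| "step (IAssign a e f) s = s\<lparr>idx := set_cell (idx s) a (ival e s) (ival f s)\<rparr>"
| "step (RAssign a e f) s = s\<lparr>num := set_cell (num s) a (ival e s) (rval f s)\<rparr>"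
| "step (Seq c c') s = step c' (step c s)"
| "step (Cond b c c') s = (if bval b s then step c s else step c' s)"
| "step (While b c) s = s"

text \<open>Both branches of a conditional are charged, an overestimate that does not depend on the
  state.\<close>

primrec ccost :: "com \<Rightarrow> nat" where
  "ccost Skip = 1"
| "ccost (IAssign a e f) = 1 + icost e + icost f"
| "ccost (RAssign a e f) = 1 + icost e + rcost f"
| "ccost (Seq c c') = 1 + ccost c + ccost c'"
| "ccost (Cond b c c') = 1 + bcost b + ccost c + ccost c'"
| "ccost (While b c) = 0"

lemma exec_loop_free: "loop_free c \<Longrightarrow> \<exists>t \<le> ccost c. exec c s t (step c s)"
proof (induction c arbitrary: s)
  case (Seq c c')
  then obtain t t' where "t \<le> ccost c" "exec c s t (step c s)"
    "t' \<le> ccost c'" "exec c' (step c s) t' (step c' (step c s))"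
    by (metis loop_free.simps(4))
  then show ?case
    using exec.Seq[of c s t "step c s" c' t'] by (intro exI[of _ "1 + t + t'"]) simp
next
  case (Cond b c c')
  show ?case
  proof (cases "bval b s")
    case True
    obtain t where "t \<le> ccost c" "exec c s t (step c s)" using Cond by auto
    then show ?thesis
      using True exec.CondTrue[OF True] by (intro exI[of _ "1 + bcost b + t"]) auto
  next
    case False
    obtain t where "t \<le> ccost c'" "exec c' s t (step c' s)" using Cond by auto
    then show ?thesis
      using False exec.CondFalse[OF False] by (intro exI[of _ "1 + bcost b + t"]) auto
  qed
next
  case (IAssign a e f) then show ?case using exec.IAssign by auto
next
  case (RAssign a e f) then show ?case using exec.RAssign by auto
next
  case Skip then show ?case using exec.Skip by auto
qed auto

lemma runs_loop_free: "loop_free c \<Longrightarrow> ccost c \<le> B \<Longrightarrow> Q (step c s) \<Longrightarrow> runs c s B Q"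
  unfolding runs_def using exec_loop_free[of c s] by (meson order_trans)

section \<open>Counting loops\<close>

abbreviation var :: "nat \<Rightarrow> iexp" where "var a \<equiv> ICell a (IConst 0)"
abbreviation rvar :: "nat \<Rightarrow> rexp" where "rvar a \<equiv> RCell a (IConst 0)"

abbreviation set_var :: "nat \<Rightarrow> nat \<Rightarrow> state \<Rightarrow> state" where
  "set_var v j s \<equiv> s\<lparr>idx := set_cell (idx s) v 0 j\<rparr>"

definition For :: "nat \<Rightarrow> nat \<Rightarrow> com \<Rightarrow> com" where
  "For v lo c = Seq (IAssign v (IConst 0) (IConst lo))
     (While (Neg (ILess (var 0) (var v)))
       (Seq c (IAssign v (IConst 0) (IAdd (var v) (IConst 1)))))"

text \<open>\<open>Inv j\<close> holds at the loop test with counter \<open>j\<close>, so the body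
  must establish \<open>Inv (Suc j)\<close> for the state after the increment. Besides the body, a
  pass costs 14: 7 for the loop and its test, 1 for sequencing, 6 for the increment. There are at
  most \<open>n + 1\<close> passes; one more share pays for the initialisation and the final
  test.\<close>

lemma runs_For:
  assumes size: "\<And>j s. Inv j s \<Longrightarrow> idx s 0 0 = n" and counter: "\<And>j s. Inv j s \<Longrightarrow> idx s v 0 = j"
    and body: "\<And>j s. lo \<le> j \<Longrightarrow> j \<le> n \<Longrightarrow> Inv j s \<Longrightarrow>
      runs c s B (\<lambda>s'. idx s' v 0 = j \<and> Inv (Suc j) (set_var v (Suc j) s'))"
    and init: "Inv lo (set_var v lo s)" and "lo \<le> Suc n"
    and Q: "\<And>s'. Inv (Suc n) s' \<Longrightarrow> Q s'"
  shows "runs (For v lo c) s ((n + 2) * (B + 14)) Q"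
proof -
  let ?b = "Neg (ILess (var 0) (var v))"
  let ?c = "Seq c (IAssign v (IConst 0) (IAdd (var v) (IConst 1)))"
  have loop: "runs (While ?b ?c) s (m * (B + 14) + 7) Q"
    if "Inv j s" "lo \<le> j" "j + m = Suc n" for m j s
    using that
  proof (induction m arbitrary: j s)
    case 0
    then have "\<not> bval ?b s" using size counter by auto
    then have "exec (While ?b ?c) s 7 s" using exec.WhileFalse[of ?b s ?c] by (simp add: eval_nat_numeral)
    moreover have "Q s" using 0 Q by simp
    ultimately show ?case unfolding runs_def by force
  next
    case (Suc m)
    then have b: "bval ?b s" using size counter by auto
    obtain t s' where 1: "exec c s t s'" "t \<le> B" "idx s' v 0 = j" "Inv (Suc j) (set_var v (Suc j) s')"
      using body[of j s] Suc.prems by (auto simp: runs_def)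
    have 2: "exec ?c s (1 + t + 6) (set_var v (Suc j) s')"
      using exec.Seq[OF 1(1) exec.IAssign[of v "IConst 0" "IAdd (var v) (IConst 1)" s']] 1(3)
      by (simp add: eval_nat_numeral)
    obtain t' s'' where 3: "exec (While ?b ?c) (set_var v (Suc j) s') t' s''"
      "t' \<le> m * (B + 14) + 7" "Q s''"
      using Suc.IH[OF 1(4)] Suc.prems by (auto simp: runs_def)
    have "exec (While ?b ?c) s (1 + 6 + (1 + t + 6) + t') s''"
      using exec.WhileTrue[OF b 2 3(1)] by simp
    moreover have "1 + 6 + (1 + t + 6) + t' \<le> Suc m * (B + 14) + 7"
      using 1(2) 3(2) by simp
    ultimately show ?case unfolding runs_def using 3(3) by blast
  qed
  have loop: "runs (While ?b ?c) (set_var v lo s) ((Suc n - lo) * (B + 14) + 7) Q"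
    using \<open>lo \<le> Suc n\<close> by (intro loop[OF init]) auto
  show ?thesis
    unfolding For_def
  proof (rule runs_Seq)
    show "runs (IAssign v (IConst 0) (IConst lo)) s 3 (\<lambda>s'. s' = set_var v lo s)"
      by (rule runs_loop_free) auto
    have "(Suc n - lo) * (B + 14) \<le> Suc n * (B + 14)" by (intro mult_right_mono) auto
    then show "Suc (3 + ((Suc n - lo) * (B + 14) + 7)) \<le> (n + 2) * (B + 14)"
      by simp
  next
    fix s' assume "s' = set_var v lo s"
    then show "runs (While ?b ?c) s' ((Suc n - lo) * (B + 14) + 7) Q" using loop by simp
  qed
qed

definition agree :: "nat set \<Rightarrow> nat set \<Rightarrow> state \<Rightarrow> state \<Rightarrow> bool" where
  "agree I R s s' \<longleftrightarrow> (\<forall>a. a \<notin> I \<longrightarrow> idx s' a = idx s a) \<and> (\<forall>a. a \<notin> R \<longrightarrow> num s' a = num s a)"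

lemma agree_trans: "agree I R s s' \<Longrightarrow> agree I' R' s' s'' \<Longrightarrow> I \<subseteq> I'' \<Longrightarrow> I' \<subseteq> I'' \<Longrightarrow> R \<subseteq> R''
    \<Longrightarrow> R' \<subseteq> R'' \<Longrightarrow> agree I'' R'' s s''"
  unfolding agree_def by (metis subsetD)

section \<open>The program\<close>

text \<open>Index arrays: 0 number of players, 1 flags of the players whose concession is settled, 2 a
  player of maximal profit, 3 some unsettled member of the current candidate coalition, 4 the player
  to be settled next; both are 0 if there is none. Arrays 5 to 8 hold the loop counters. Real arrays:
  3 settled concessions, 4 and 5 numerator and denominator of the current candidate's water level, 6
  least level, 7 total concession.\<close>

definition find_top :: com where
  "find_top = Seq (IAssign 2 (IConst 0) (IConst 1))
     (Seq (For 5 1 (Cond (RLess (RCell 0 (var 2)) (RCell 0 (var 5)))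
        (IAssign 2 (IConst 0) (var 5)) Skip))
     (IAssign 1 (var 2) (IConst 1)))"

definition unit_cost :: rexp where
  "unit_cost = RMul (RSub (RCell 0 (var 2)) (RCell 0 (var 7))) (RCell 1 (var 5))"

definition Disj :: "bexp \<Rightarrow> bexp \<Rightarrow> bexp" where
  "Disj b c = Neg (Conj (Neg b) (Neg c))"

definition IEq :: "iexp \<Rightarrow> iexp \<Rightarrow> bexp" where
  "IEq e f = Conj (Neg (ILess e f)) (Neg (ILess f e))"

definition selected :: bexp where
  "selected = Disj (IEq (var 5) (var 7)) (Disj (RLess unit_cost (RCell 3 (var 5)))
     (Conj (ILess (ICell 1 (var 5)) (IConst 1))
       (Disj (RLess (RCell 1 (var 5)) (RCell 1 (var 6)))
         (Conj (Neg (RLess (RCell 1 (var 6)) (RCell 1 (var 5)))) (Neg (ILess (var 6) (var 5)))))))"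

definition add_player :: com where
  "add_player = Cond selected
     (Seq (RAssign 4 (IConst 0) (RAdd (rvar 4) (RSub unit_cost (RCell 3 (var 5)))))
       (Cond (ILess (ICell 1 (var 5)) (IConst 1))
         (Seq (RAssign 5 (IConst 0) (RAdd (rvar 5) (RConst 1))) (IAssign 3 (IConst 0) (var 5)))
         Skip))
     Skip"

text \<open>The denominator starts at 1 because the excess of the coalition itself takes one share
  of the water besides the unsettled members. This also keeps it positive.\<close>

definition scan :: com where
  "scan = Seq (Seq (RAssign 4 (IConst 0) (RConst 0)) (Seq (RAssign 5 (IConst 0) (RConst 1))
      (IAssign 3 (IConst 0) (IConst 0))))
    (For 5 1 add_player)"

definition update_best :: com where
  "update_best = Cond (Conj (ILess (IConst 0) (var 3))
       (Disj (ILess (var 4) (IConst 1)) (RLess (RDiv (rvar 4) (rvar 5)) (rvar 6))))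
     (Seq (RAssign 6 (IConst 0) (RDiv (rvar 4) (rvar 5))) (IAssign 4 (IConst 0) (var 3)))
     Skip"

definition search :: com where
  "search = Seq (IAssign 4 (IConst 0) (IConst 0))
     (For 7 1 (Cond (IEq (var 7) (var 2)) Skip (For 6 0 (Seq scan update_best))))"

definition settle :: com where
  "settle = Cond (ILess (IConst 0) (var 4))
     (Seq (RAssign 3 (var 4) (rvar 6)) (IAssign 1 (var 4) (IConst 1))) Skip"

definition write_payoffs :: com where
  "write_payoffs = Seq (For 5 1 (Seq
       (RAssign 2 (var 5) (RSub (RMul (RCell 0 (var 2)) (RCell 1 (var 5))) (RCell 3 (var 5))))
       (RAssign 7 (IConst 0) (RAdd (rvar 7) (RCell 3 (var 5))))))
     (RAssign 2 (var 2) (RAdd (RCell 2 (var 2)) (rvar 7)))"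

definition nucleolus_program :: com where
  "nucleolus_program = Seq find_top (Seq (For 8 1 (Seq search settle)) write_payoffs)"

section \<open>Quantities read off a state and the scan of one candidate\<close>

definition settled :: "state \<Rightarrow> nat set" where
  "settled s = {i. idx s 1 i \<noteq> 0}"

text \<open>The machine counterpart of \<open>cand\<close>. The top player is kept out by its
  settled flag and its zero concession when \<open>k\<close> is another player.\<close>

definition coalition :: "state \<Rightarrow> nat \<Rightarrow> nat \<Rightarrow> nat set" where
  "coalition s k j = {i \<in> {1..idx s 0 0}. i = k
     \<or> (num s 0 (idx s 2 0) - num s 0 k) * num s 1 i < num s 3 i
     \<or> i \<notin> settled s \<and> before (num s 1) i j}"

definition cost_of :: "state \<Rightarrow> nat \<Rightarrow> nat \<Rightarrow> real" where
  "cost_of s k i = (num s 0 (idx s 2 0) - num s 0 k) * num s 1 i - num s 3 i"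

lemma coalition_cong:
  "agree I R s s' \<Longrightarrow> {0, 1, 2} \<inter> I = {} \<Longrightarrow> {0, 1, 3} \<inter> R = {} \<Longrightarrow> coalition s' k j = coalition s k j"
  "agree I R s s' \<Longrightarrow> {0, 1, 2} \<inter> I = {} \<Longrightarrow> {0, 1, 3} \<inter> R = {} \<Longrightarrow> cost_of s' k = cost_of s k"
  "agree I R s s' \<Longrightarrow> {0, 1, 2} \<inter> I = {} \<Longrightarrow> settled s' = settled s"
  by (simp_all add: coalition_def cost_of_def[abs_def] settled_def agree_def)

text \<open>\<open>post\<close> is parametric in the sets so that the invariant is
  \<open>post\<close> for the members below the counter. The factor 200 is 186 for
  \<open>add_player\<close> plus the loop overhead 14.\<close>

lemma runs_scan:
  defines "post \<equiv> \<lambda>s S U s'. agree {3, 5} {4, 5} s s'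
     \<and> num s' 4 0 = sum (cost_of s (idx s 7 0)) S \<and> num s' 5 0 = real (card U) + 1
     \<and> (if U = {} then idx s' 3 0 = 0 else idx s' 3 0 \<in> U)"
  assumes S: "S = coalition s (idx s 7 0) (idx s 6 0)" and U: "U = S - settled s"
  shows "runs scan s ((idx s 0 0 + 2) * 200 + 20) (post s S U)"
proof -
  define n where "n = idx s 0 0"
  define c where "c = cost_of s (idx s 7 0)"
  have Sn: "S \<subseteq> {1..n}" "U \<subseteq> S" and fin: "finite S" "finite U"
    unfolding S U n_def by (auto simp: coalition_def)
  let ?I = "\<lambda>i s'. idx s' 5 0 = i \<and> post s (S \<inter> {..<i}) (U \<inter> {..<i}) s'"
  have loop: "runs (For 5 1 add_player) s1 ((n + 2) * (186 + 14)) (post s S U)"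
    if "?I 1 (set_var 5 1 s1)" for s1
  proof (rule runs_For[where Inv = ?I and n = n, OF _ _ _ that])
    fix i s' assume i: "1 \<le> i" "i \<le> n" and I: "?I i s'"
    have I': "agree {3, 5} {4, 5} s s'" "idx s' 5 0 = i" "num s' 4 0 = sum c (S \<inter> {..<i})"
      "num s' 5 0 = real (card (U \<inter> {..<i})) + 1"
      "if U \<inter> {..<i} = {} then idx s' 3 0 = 0 else idx s' 3 0 \<in> U \<inter> {..<i}"
      using I unfolding post_def c_def by blast+
    have "idx s' 0 = idx s 0" "idx s' 1 = idx s 1" "idx s' 2 = idx s 2" "idx s' 6 = idx s 6"
      "idx s' 7 = idx s 7" "num s' 0 = num s 0" "num s' 1 = num s 1" "num s' 3 = num s 3"
      using I'(1) by (simp_all add: agree_def)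
    note arr = this this[unfolded One_nat_def]
    have sel: "bval selected s' \<longleftrightarrow> i \<in> S"
      using i unfolding S n_def
      by (auto simp: selected_def Disj_def IEq_def unit_cost_def coalition_def settled_def
        before_def arr I'(2))
    have flag: "i \<in> S \<Longrightarrow> idx s' 1 i = 0 \<longleftrightarrow> i \<in> U"
      by (auto simp: settled_def arr U)
    have cost: "rval unit_cost s' - num s' 3 i = c i"
      by (simp add: unit_cost_def cost_of_def c_def arr I'(2))
    have ins: "A \<inter> {..<Suc i} = (if i \<in> A then insert i (A \<inter> {..<i}) else A \<inter> {..<i})" for A
      by (auto simp: less_Suc_eq)
    have advance: "?I (Suc i) (set_var 5 (Suc i) (step add_player s')) \<and> idx (step add_player s') 5 0 = i"
    proof (cases "i \<in> S")
      case True
      show ?thesis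
      proof (cases "i \<in> U")
        case False
        then have "step add_player s' = s'\<lparr>num := set_cell (num s') 4 0 (num s' 4 0 + c i)\<rparr>"
          using True flag sel cost I'(2) by (simp add: add_player_def)
        then show ?thesis
          unfolding ins post_def c_def[symmetric] using True False I' fin
          by (simp add: set_cell_def agree_def split: if_splits)
      next
        case U: True
        then have "step add_player s' = s'\<lparr>num := set_cell (set_cell (num s') 4 0 (num s' 4 0 + c i)) 5 0 (num s' 5 0 + 1),
            idx := set_cell (idx s') 3 0 i\<rparr>"
          using True flag sel cost I'(2) by (simp add: add_player_def set_cell_def)
        then show ?thesis
          unfolding ins post_def c_def[symmetric] using True U I' fin
          by (simp add: set_cell_def agree_def)
      qed
    next
      case False
      then have "i \<notin> U" using Sn by auto
      have "step add_player s' = s'" using sel False by (simp add: add_player_def)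
      then show ?thesis
        unfolding ins post_def c_def[symmetric] using False \<open>i \<notin> U\<close> I'
        by (simp add: set_cell_def agree_def split: if_splits)
    qed
    show "runs add_player s' 186 (\<lambda>s''. idx s'' 5 0 = i \<and> ?I (Suc i) (set_var 5 (Suc i) s''))"
    proof (rule runs_loop_free)
      show "idx (step add_player s') 5 0 = i \<and> ?I (Suc i) (set_var 5 (Suc i) (step add_player s'))"
        using advance by blast
    qed (simp_all add: add_player_def selected_def Disj_def IEq_def unit_cost_def)
  next
    fix s' assume "?I (Suc n) s'"
    moreover have "S \<inter> {..<Suc n} = S" "U \<inter> {..<Suc n} = U" using Sn by auto
    ultimately show "post s S U s'" by simp
  qed (auto simp: post_def agree_def n_def)
  have "runs scan s ((n + 2) * (186 + 14) + 12) (post s S U)"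
    unfolding scan_def
  proof (rule runs_Seq)
    let ?Q = "\<lambda>s'. agree {3, 5} {4, 5} s s' \<and> num s' 4 0 = 0 \<and> num s' 5 0 = 1 \<and> idx s' 3 0 = 0"
    show "runs (Seq (RAssign 4 (IConst 0) (RConst 0)) (Seq (RAssign 5 (IConst 0) (RConst 1))
      (IAssign 3 (IConst 0) (IConst 0)))) s 11 ?Q"
      by (rule runs_loop_free) (auto simp: set_cell_def agree_def)
    fix s1 assume "?Q s1"
    moreover have "S \<inter> {..<1} = {}" "U \<inter> {..<1} = {}" using Sn by auto
    ultimately have "?I 1 (set_var 5 1 s1)"
      unfolding post_def by (simp add: set_cell_def agree_def)
    then show "runs (For 5 1 add_player) s1 ((n + 2) * (186 + 14)) (post s S U)"
      by (rule loop)
  qed simp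
  then show ?thesis by (rule runs_mono) (simp_all add: n_def)
qed

section \<open>The search for the least water level\<close>

definition level :: "state \<Rightarrow> nat \<Rightarrow> nat \<Rightarrow> real" where
  "level s k j = sum (cost_of s k) (coalition s k j) / (real (card (coalition s k j - settled s)) + 1)"

text \<open>An argmin invariant over the pairs \<open>D\<close> inspected so far, ignoring
  candidates without unsettled members. Players are numbered from 1, which frees 0 to mean that none
  was found.\<close>

definition best :: "state \<Rightarrow> (nat \<times> nat) set \<Rightarrow> state \<Rightarrow> bool" where
  "best s D s' \<longleftrightarrow> (if idx s' 4 0 = 0 then \<forall>(k, j)\<in>D. coalition s k j - settled s = {}
     else (\<exists>(k, j)\<in>D. idx s' 4 0 \<in> coalition s k j - settled s \<and> num s' 6 0 = level s k j) \<and>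
       (\<forall>(k, j)\<in>D. coalition s k j - settled s \<noteq> {} \<longrightarrow> num s' 6 0 \<le> level s k j))"

lemma runs_candidate:
  defines "I \<equiv> \<lambda>s D s'. agree {3, 4, 5, 6, 7} {4, 5, 6} s s' \<and> best s D s'"
  assumes inv: "I s D s'" and kj: "idx s' 7 0 = k" "idx s' 6 0 = j"
  shows "runs (Seq scan update_best) s' ((idx s 0 0 + 2) * 200 + 60)
    (\<lambda>s''. idx s'' 7 0 = k \<and> idx s'' 6 0 = j \<and> I s (insert (k, j) D) s'')"
proof (rule runs_Seq)
  define S U where "S = coalition s k j" and "U = S - settled s"
  have ag: "agree {3, 4, 5, 6, 7} {4, 5, 6} s s'" and D: "best s D s'"
    using inv by (simp_all add: I_def)
  have "idx s' 0 = idx s 0" using ag by (simp add: agree_def)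
  moreover have "coalition s' k j = coalition s k j" "cost_of s' k = cost_of s k" "settled s' = settled s"
    using coalition_cong[OF ag] by auto
  ultimately show "runs scan s' ((idx s 0 0 + 2) * 200 + 20) (\<lambda>s''. agree {3, 5} {4, 5} s' s''
     \<and> num s'' 4 0 = sum (cost_of s k) S \<and> num s'' 5 0 = real (card U) + 1
     \<and> (if U = {} then idx s'' 3 0 = 0 else idx s'' 3 0 \<in> U))"
    using runs_scan[OF refl refl, of s'] unfolding kj S_def U_def by metis
  fix t assume t: "agree {3, 5} {4, 5} s' t
     \<and> num t 4 0 = sum (cost_of s k) S \<and> num t 5 0 = real (card U) + 1
     \<and> (if U = {} then idx t 3 0 = 0 else idx t 3 0 \<in> U)"
  \<comment> \<open>Hence a positive entry in array 3 signals an unsettled member, as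
    \<open>update_best\<close> tests.\<close>
  have U0: "0 \<notin> U" by (simp add: U_def S_def coalition_def)
  have ag': "agree {3, 4, 5, 6, 7} {4, 5, 6} s t"
    using ag t by (auto intro: agree_trans)
  have t': "idx t 7 0 = k" "idx t 6 0 = j" "idx t 4 0 = idx s' 4 0" "num t 6 0 = num s' 6 0"
    "num t 4 0 / num t 5 0 = level s k j"
    using t kj by (simp_all add: agree_def level_def S_def U_def)
  show "runs update_best t 39 (\<lambda>s''. idx s'' 7 0 = k \<and> idx s'' 6 0 = j \<and> I s (insert (k, j) D) s'')"
  proof (rule runs_loop_free)
    show "idx (step update_best t) 7 0 = k \<and> idx (step update_best t) 6 0 = j
      \<and> I s (insert (k, j) D) (step update_best t)"
    proof (cases "U \<noteq> {} \<and> (idx s' 4 0 = 0 \<or> level s k j < num s' 6 0)")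
      case True
      then have U: "idx t 3 0 \<in> U" "0 < idx t 3 0" using t U0 by (auto intro!: gr0I)
      then have st: "step update_best t
          = t\<lparr>num := set_cell (num t) 6 0 (level s k j), idx := set_cell (idx t) 4 0 (idx t 3 0)\<rparr>"
        using True t' by (auto simp: update_best_def Disj_def set_cell_def)
      have "coalition s k' j' - settled s \<noteq> {} \<longrightarrow> level s k j \<le> level s k' j'"
        if "(k', j') \<in> D" for k' j'
        using True D that unfolding best_def by (fastforce split: if_splits)
      then have "best s (insert (k, j) D) (step update_best t)"
        using U unfolding st best_def U_def S_def by (auto simp: set_cell_def)
      then show ?thesis
        using ag' t' unfolding I_def st by (auto simp: set_cell_def agree_def)
    next
      case False
      then have st: "step update_best t = t"
        using t t' U0 by (auto simp: update_best_def Disj_def)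
      have "best s (insert (k, j) D) t"
        using False D t' unfolding best_def U_def S_def by (auto split: if_splits)
      then show ?thesis
        using ag' t' unfolding I_def st by simp
    qed
  qed (auto simp: update_best_def Disj_def)
qed simp

text \<open>The inspected set grows by one pair in the inner loop and by a row in the outer one,
  skipping the row of the top player. With the scan inside, three nested loops give cubic
  cost.\<close>

lemma runs_search:
  fixes s
  defines "n \<equiv> idx s 0 0"
  shows "runs search s ((n + 2) * ((n + 2) * ((n + 2) * 200 + 74) + 40) + 10) (\<lambda>s'.
    agree {3, 4, 5, 6, 7} {4, 5, 6} s s' \<and> best s (({1..n} - {idx s 2 0}) \<times> {0..n}) s')"
proof -
  define p where "p = idx s 2 0"
  let ?agree = "agree {3, 4, 5, 6, 7} {4, 5, 6} s"
  let ?I = "\<lambda>k s'. idx s' 7 0 = k \<and> ?agree s' \<and> best s (({1..<k} - {p}) \<times> {0..n}) s'"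
  have best_cong: "best s D (set_var v j s') = best s D s'" if "v \<noteq> 4" for D v j s'
    using that by (simp add: best_def set_cell_def)
  have agree_set: "?agree (set_var v j s') = ?agree s'" if "v \<in> {6, 7}" for v j s'
    using that by (auto simp: agree_def set_cell_def)
  have inner: "runs (For 6 0 (Seq scan update_best)) s' ((n + 2) * ((n + 2) * 200 + 60 + 14))
      (\<lambda>s''. idx s'' 7 0 = k \<and> ?agree s'' \<and> best s (D \<union> {k} \<times> {0..n}) s'')"
    if "idx s' 7 0 = k" "?agree s'" "best s D s'" for k D s'
  proof (rule runs_For[where n = n and
      Inv = "\<lambda>j s'. idx s' 7 0 = k \<and> idx s' 6 0 = j \<and> ?agree s' \<and> best s (D \<union> {k} \<times> {..<j}) s'"])
    fix j s'
    assume I: "idx s' 7 0 = k \<and> idx s' 6 0 = j \<and> ?agree s' \<and> best s (D \<union> {k} \<times> {..<j}) s'"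
    have "insert (k, j) (D \<union> {k} \<times> {..<j}) = D \<union> {k} \<times> {..<Suc j}" by auto
    then have "runs (Seq scan update_best) s' ((n + 2) * 200 + 60)
        (\<lambda>s''. idx s'' 7 0 = k \<and> idx s'' 6 0 = j \<and> ?agree s'' \<and> best s (D \<union> {k} \<times> {..<Suc j}) s'')"
      using runs_candidate[where s = s and D = "D \<union> {k} \<times> {..<j}" and s' = s' and k = k and j = j] I unfolding n_def by simp
    then show "runs (Seq scan update_best) s' ((n + 2) * 200 + 60)
        (\<lambda>s''. idx s'' 6 0 = j \<and> idx (set_var 6 (Suc j) s'') 7 0 = k
          \<and> idx (set_var 6 (Suc j) s'') 6 0 = Suc j \<and> ?agree (set_var 6 (Suc j) s'')
          \<and> best s (D \<union> {k} \<times> {..<Suc j}) (set_var 6 (Suc j) s''))"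
      by (rule runs_mono) (auto simp: best_cong agree_set, auto simp: set_cell_def)
  next
    fix s' assume "idx s' 7 0 = k \<and> idx s' 6 0 = Suc n \<and> ?agree s' \<and> best s (D \<union> {k} \<times> {..<Suc n}) s'"
    moreover have "{..<Suc n} = {0..n}" by auto
    ultimately show "idx s' 7 0 = k \<and> ?agree s' \<and> best s (D \<union> {k} \<times> {0..n}) s'" by simp
  next
    show "idx (set_var 6 0 s') 7 0 = k \<and> idx (set_var 6 0 s') 6 0 = 0 \<and> ?agree (set_var 6 0 s')
        \<and> best s (D \<union> {k} \<times> {..<0}) (set_var 6 0 s')"
      using that by (simp add: best_cong agree_set) (simp add: set_cell_def)
  qed (auto simp: agree_def n_def)
  have outer: "runs (For 7 1 (Cond (IEq (var 7) (var 2)) Skip (For 6 0 (Seq scan update_best)))) s'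
      ((n + 2) * ((n + 2) * ((n + 2) * 200 + 74) + 26 + 14)) (\<lambda>s'. ?agree s' \<and> best s (({1..n} - {p}) \<times> {0..n}) s')"
    if "?agree s'" "best s {} s'" for s'
  proof (rule runs_For[where n = n and Inv = ?I])
    fix k s' assume k: "1 \<le> k" and I: "?I k s'"
    then have test: "bval (IEq (var 7) (var 2)) s' \<longleftrightarrow> k = p"
      by (auto simp: IEq_def p_def agree_def)
    let ?D = "({1..<Suc k} - {p}) \<times> {0..n}"
    have "runs (Cond (IEq (var 7) (var 2)) Skip (For 6 0 (Seq scan update_best))) s'
      ((n + 2) * ((n + 2) * 200 + 74) + 26) (\<lambda>s''. idx s'' 7 0 = k \<and> ?agree s'' \<and> best s ?D s'')"
    proof (rule runs_Cond)
      assume "bval (IEq (var 7) (var 2)) s'"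
      then have "{1..<Suc k} - {p} = {1..<k} - {p}" by (auto simp: test)
      then show "runs Skip s' ((n + 2) * ((n + 2) * 200 + 60 + 14))
          (\<lambda>s''. idx s'' 7 0 = k \<and> ?agree s'' \<and> best s ?D s'')"
        using I by (intro runs_loop_free) simp_all
    next
      assume "\<not> bval (IEq (var 7) (var 2)) s'"
      then have "?D = ({1..<k} - {p}) \<times> {0..n} \<union> {k} \<times> {0..n}" using k by (auto simp: test)
      then show "runs (For 6 0 (Seq scan update_best)) s' ((n + 2) * ((n + 2) * 200 + 60 + 14))
          (\<lambda>s''. idx s'' 7 0 = k \<and> ?agree s'' \<and> best s ?D s'')"
        using inner[of s' k "({1..<k} - {p}) \<times> {0..n}"] I by simp
    qed (simp add: IEq_def)
    then show "runs (Cond (IEq (var 7) (var 2)) Skip (For 6 0 (Seq scan update_best))) s'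
      ((n + 2) * ((n + 2) * 200 + 74) + 26) (\<lambda>s''. idx s'' 7 0 = k \<and> ?I (Suc k) (set_var 7 (Suc k) s''))"
      by (rule runs_mono) (auto simp: best_cong agree_set, auto simp: set_cell_def)
  next
    fix s' assume "?I (Suc n) s'"
    moreover have "{1..<Suc n} = {1..n}" by auto
    ultimately show "?agree s' \<and> best s (({1..n} - {p}) \<times> {0..n}) s'" by simp
  next
    show "?I 1 (set_var 7 1 s')"
      using that by (simp add: best_cong agree_set) (simp add: set_cell_def)
  qed (auto simp: agree_def n_def)
  show ?thesis
    unfolding search_def p_def[symmetric]
  proof (rule runs_Seq)
    show "runs (IAssign 4 (IConst 0) (IConst 0)) s 3 (\<lambda>s'. ?agree s' \<and> best s {} s')"
      by (rule runs_loop_free) (auto simp: agree_def best_def set_cell_def)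
  qed (use outer in auto)
qed

text \<open>Flagging the top player as settled excludes it from the unsettled ones for good. If
  \<open>n = 0\<close>, array 2 still holds 1, hence the guard \<open>1 \<le> n\<close>.\<close>

lemma runs_find_top:
  fixes s
  defines "n \<equiv> idx s 0 0"
  shows "runs find_top s ((n + 2) * 50 + 20) (\<lambda>s'. let p = idx s' 2 0 in agree {1, 2, 5} {} s s'
    \<and> idx s' 1 = (idx s 1)(p := 1)
    \<and> (1 \<le> n \<longrightarrow> p \<in> {1..n} \<and> (\<forall>i\<in>{1..n}. num s 0 i \<le> num s 0 p)))"
proof -
  let ?body = "Cond (RLess (RCell 0 (var 2)) (RCell 0 (var 5))) (IAssign 2 (IConst 0) (var 5)) Skip"
  let ?P = "\<lambda>j s'. agree {2, 5} {} s s' \<and> 1 \<le> idx s' 2 0 \<and> (1 \<le> n \<longrightarrow> idx s' 2 0 \<le> n)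
    \<and> (\<forall>i\<in>{1..<j}. num s 0 i \<le> num s 0 (idx s' 2 0))"
  let ?I = "\<lambda>j s'. idx s' 5 0 = j \<and> ?P j s'"
  have loop: "runs (For 5 1 ?body) s1 ((n + 2) * (36 + 14)) (?P (Suc n))"
    if "?I 1 (set_var 5 1 s1)" for s1
  proof (rule runs_For[where Inv = ?I and n = n, OF _ _ _ that])
    fix j s' assume j: "1 \<le> j" "j \<le> n" and I: "?I j s'"
    have num: "num s' = num s" using I by (auto simp: agree_def)
    have *: "(\<forall>i\<in>{1..<Suc j}. Q i) \<longleftrightarrow> (\<forall>i\<in>{1..<j}. Q i) \<and> Q j" for Q
      using j by (auto simp: less_Suc_eq)
    show "runs ?body s' 36 (\<lambda>s''. idx s'' 5 0 = j \<and> ?I (Suc j) (set_var 5 (Suc j) s''))"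
    proof (rule runs_loop_free)
      show "idx (step ?body s') 5 0 = j \<and> ?I (Suc j) (set_var 5 (Suc j) (step ?body s'))"
        unfolding * using I j by (auto simp: num set_cell_def agree_def intro: less_imp_le order_trans)
    qed auto
  qed (auto simp: agree_def n_def)
  have rest: "runs (Seq (For 5 1 ?body) (IAssign 1 (var 2) (IConst 1))) s1 ((n + 2) * 50 + 10)
      (\<lambda>s'. let p = idx s' 2 0 in agree {1, 2, 5} {} s s' \<and> idx s' 1 = (idx s 1)(p := 1)
        \<and> (1 \<le> n \<longrightarrow> p \<in> {1..n} \<and> (\<forall>i\<in>{1..n}. num s 0 i \<le> num s 0 p)))"
    if "?I 1 (set_var 5 1 s1)" for s1
  proof (rule runs_Seq)
    show "runs (For 5 1 ?body) s1 ((n + 2) * (36 + 14)) (?P (Suc n))"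
      by (rule loop) fact
    fix s2 assume P: "?P (Suc n) s2"
    show "runs (IAssign 1 (var 2) (IConst 1)) s2 4
      (\<lambda>s'. let p = idx s' 2 0 in agree {1, 2, 5} {} s s' \<and> idx s' 1 = (idx s 1)(p := 1)
        \<and> (1 \<le> n \<longrightarrow> p \<in> {1..n} \<and> (\<forall>i\<in>{1..n}. num s 0 i \<le> num s 0 p)))"
      by (rule runs_loop_free) (use P in \<open>auto simp: Let_def set_cell_def agree_def less_Suc_eq_le\<close>)
  qed simp
  show ?thesis
    unfolding find_top_def
  proof (rule runs_Seq)
    show "runs (IAssign 2 (IConst 0) (IConst 1)) s 3 (\<lambda>s1. ?I 1 (set_var 5 1 s1))"
      by (rule runs_loop_free) (auto simp: agree_def set_cell_def)
  qed (use rest in auto)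
qed

lemma runs_write_payoffs:
  fixes s
  defines "n \<equiv> idx s 0 0" and "p \<equiv> idx s 2 0"
  shows "runs write_payoffs s ((n + 2) * 50 + 20) (\<lambda>s'. \<forall>i\<in>{1..n}.
    num s' 2 i = num s 0 p * num s 1 i - num s 3 i
      + (if i = p then num s 7 0 + sum (num s 3) {1..n} else 0))"
proof -
  let ?body = "Seq
       (RAssign 2 (var 5) (RSub (RMul (RCell 0 (var 2)) (RCell 1 (var 5))) (RCell 3 (var 5))))
       (RAssign 7 (IConst 0) (RAdd (rvar 7) (RCell 3 (var 5))))"
  let ?P = "\<lambda>j s'. agree {5} {2, 7} s s' \<and> num s' 7 0 = num s 7 0 + sum (num s 3) {1..<j}
    \<and> (\<forall>i\<in>{1..<j}. num s' 2 i = num s 0 p * num s 1 i - num s 3 i)"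
  let ?I = "\<lambda>j s'. idx s' 5 0 = j \<and> ?P j s'"
  show ?thesis
    unfolding write_payoffs_def
  proof (rule runs_Seq)
    show "runs (For 5 1 ?body) s ((n + 2) * (36 + 14)) (?P (Suc n))"
    proof (rule runs_For[where Inv = ?I and n = n])
      fix j s' assume j: "1 \<le> j" "j \<le> n" and I: "?I j s'"
      have arr: "num s' 0 = num s 0" "num s' (Suc 0) = num s (Suc 0)" "num s' 3 = num s 3"
        "idx s' 2 0 = p" "idx s' 5 0 = j"
        using I by (auto simp: agree_def p_def)
      have *: "(\<forall>i\<in>{1..<Suc j}. Q i) \<longleftrightarrow> (\<forall>i\<in>{1..<j}. Q i) \<and> Q j" for Q
        using j by (auto simp: less_Suc_eq)
      have sum: "sum (num s 3) {1..<Suc j} = sum (num s 3) {1..<j} + num s 3 j"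
        using j by (simp add: sum.atLeastLessThan_Suc)
      show "runs ?body s' 36 (\<lambda>s''. idx s'' 5 0 = j \<and> ?I (Suc j) (set_var 5 (Suc j) s''))"
      proof (rule runs_loop_free)
        show "idx (step ?body s') 5 0 = j \<and> ?I (Suc j) (set_var 5 (Suc j) (step ?body s'))"
          unfolding * sum using I j by (auto simp: arr set_cell_def agree_def p_def)
      qed auto
    qed (auto simp: agree_def n_def set_cell_def)
    fix s' assume P: "?P (Suc n) s'"
    have p: "idx s' 2 0 = p" using P by (simp add: agree_def p_def)
    have P': "num s' 7 0 = num s 7 0 + sum (num s 3) {1..n}"
      "\<And>i. i \<in> {1..n} \<Longrightarrow> num s' 2 i = num s 0 p * num s 1 i - num s 3 i"
      using P by (auto simp: atLeastLessThanSuc_atLeastAtMost)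
    show "runs (RAssign 2 (var 2) (RAdd (RCell 2 (var 2)) (rvar 7))) s' 9 (\<lambda>s'. \<forall>i\<in>{1..n}.
      num s' 2 i = num s 0 p * num s 1 i - num s 3 i
        + (if i = p then num s 7 0 + sum (num s 3) {1..n} else 0))"
      by (rule runs_loop_free) (use P' in \<open>auto simp: set_cell_def p\<close>)
  qed simp
qed

section \<open>The rounds of water filling\<close>

definition filled :: "nat \<Rightarrow> (nat \<Rightarrow> real) \<Rightarrow> (nat \<Rightarrow> real) \<Rightarrow> nat \<Rightarrow> nat set \<Rightarrow> real \<Rightarrow> state \<Rightarrow> bool" where
  "filled n \<alpha> d p F t s \<longleftrightarrow> idx s 0 0 = n \<and> idx s 2 0 = p \<and> num s 0 = \<alpha> \<and> num s 1 = d
    \<and> num s 7 0 = 0 \<and> F \<subseteq> {1..n} - {p} \<and> settled s = insert p F \<and> (\<forall>i\<in>{1..n} - F. num s 3 i = 0)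
    \<and> (\<forall>i\<in>F. num s 3 i \<le> t)
    \<and> pd_game.equitable {1..n} \<alpha> d p (\<lambda>i. if i \<in> F then num s 3 i else t) F"

lemma filled_agree:
  assumes "filled n \<alpha> d p F t s" and "agree {3, 4, 5, 6, 7, 8} {4, 5, 6} s s'"
  shows "filled n \<alpha> d p F t s'"
proof -
  have "idx s' 0 = idx s 0" "idx s' 1 = idx s 1" "idx s' 2 = idx s 2" "num s' 0 = num s 0"
    "num s' 1 = num s 1" "num s' 3 = num s 3" "num s' 7 = num s 7"
    using assms(2) by (simp_all add: agree_def)
  then show ?thesis using assms(1) unfolding filled_def settled_def by metis
qed

text \<open>The bridge from program to game: the player and the level found by the search are
  \<open>e\<close> and \<open>r\<close> of \<open>equitable_raise\<close>, so the round invariant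
  \<open>filled\<close> passes to the new level.\<close>

lemma filled_settle:
  assumes "pd_nat {1..n} \<alpha> d p" and s: "filled n \<alpha> d p F t s"
    and best: "best s (({1..n} - {p}) \<times> {0..n}) s'" and e: "idx s' 4 0 \<noteq> 0"
    and ag: "agree {3, 4, 5, 6, 7} {4, 5, 6} s s'"
  shows "idx s' 4 0 \<in> {1..n} - {p} - F"
    and "filled n \<alpha> d p (insert (idx s' 4 0) F) (num s' 6 0) (step settle s')"
proof -
  interpret pd_nat "{1..n}" \<alpha> d p by fact
  define y e r where "y = num s 3" and "e = idx s' 4 0" and "r = num s' 6 0"
  let ?M = "{1..n} - {p}"
  note s' = s[unfolded filled_def, folded y_def]
  have n: "idx s 0 0 = n" "idx s 2 0 = p" "num s 0 = \<alpha>" "num s 1 = d" "settled s = insert p F"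
    using s' by simp_all
  have sum1: "0 < real m + 1" for m by simp
  \<comment> \<open>\<open>p\<close> fails every membership test: it differs from \<open>k\<close>,
    its unit cost is non-negative while its concession is 0, and it is flagged.\<close>
  have coal: "coalition s k j = cand F y k j" if "k \<in> ?M" for k j
  proof -
    have "0 \<le> (\<alpha> p - \<alpha> k) * d p" using that pN top[of k] d_nonneg[of p] by simp
    moreover have "y p = 0" using s' pN by auto
    ultimately show ?thesis
      using that unfolding coalition_def cand_def n y_def[symmetric] by auto
  qed
  have free: "coalition s k j - settled s = cand F y k j - F" if "k \<in> ?M" for k j
    unfolding coal[OF that] n unfolding cand_def by auto
  have level: "level s k j = cost y k (cand F y k j) / (real (card (cand F y k j - F)) + 1)"
    if "k \<in> ?M" for k j
    unfolding level_def free[OF that] unfolding coal[OF that] cost_def cost_of_def n y_def ..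
  have insert0: "insert 0 {1..n} = {0..n}" by auto
  have "\<exists>(k, j)\<in>?M \<times> {0..n}. e \<in> coalition s k j - settled s \<and> r = level s k j"
    and all: "\<forall>(k, j)\<in>?M \<times> {0..n}. coalition s k j - settled s \<noteq> {} \<longrightarrow> r \<le> level s k j"
    using best e unfolding best_def e_def r_def by presburger+
  then obtain k j where kj: "k \<in> ?M" "e \<in> cand F y k j - F" "r = level s k j"
    using free by blast
  then show eM: "idx s' 4 0 \<in> ?M - F" unfolding cand_def e_def by blast
  have least: "r \<le> level s k j" if "k \<in> ?M" "j \<in> {0..n}" "cand F y k j - F \<noteq> {}" for k j
    using all that free[OF that(1), of j] by blast
  have raised: "equitable (\<lambda>i. if i \<in> insert e F then (y(e := r)) i else r) (insert e F) \<and> t \<le> r"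
  proof (rule equitable_raise)
    show "F \<subseteq> ?M" "equitable (\<lambda>i. if i \<in> F then y i else t) F" using s' by simp_all
    show "y i = 0" if "i \<in> ?M - F" for i using s' that by simp
    show "y i \<le> t" if "i \<in> F" for i using s' that by simp
    show "r * (real (card (cand F y k j - F)) + 1) \<le> cost y k (cand F y k j)"
      if "k \<in> ?M" "j \<in> insert 0 {1..n}" "cand F y k j - F \<noteq> {}" for k j
      using least[of k j] that unfolding level[OF that(1)] insert0 by (simp add: pos_le_divide_eq sum1)
    show "cand F y k j \<subseteq> ?M" "k \<in> cand F y k j"
      unfolding cand_def using kj(1) by blast+
    show "e \<in> cand F y k j - F" by (rule kj(2))
    show "r * (real (card (cand F y k j - F)) + 1) = cost y k (cand F y k j)"
      using kj sum1[of "card (cand F y k j - F)"] by (simp add: level)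
  qed
  define s2 where "s2 = step settle s'"
  have st: "s2 = s'\<lparr>num := set_cell (num s') 3 e r, idx := set_cell (idx s') 1 e 1\<rparr>"
    using e by (simp add: s2_def settle_def set_cell_def e_def r_def)
  have "idx s2 0 = idx s 0" "idx s2 2 = idx s 2" "num s2 0 = num s 0" "num s2 1 = num s 1"
    "num s2 7 = num s 7" "num s2 3 = y(e := r)" "settled s2 = insert e (settled s)"
    unfolding st settled_def using ag by (auto simp: set_cell_def agree_def y_def)
  note arr = this[unfolded n]
  have yr: "(y(e := r)) i \<le> r" if "i \<in> insert e F" for i
    using s' raised that by auto
  have y0: "(y(e := r)) i = 0" if "i \<in> {1..n} - insert e F" for i
    using s' that by auto
  have "insert e F \<subseteq> ?M" "num s 7 0 = 0" using s' eM by (auto simp: e_def)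
  then have "filled n \<alpha> d p (insert e F) r s2"
    unfolding filled_def arr using raised yr y0 n by (simp add: insert_commute)
  then show "filled n \<alpha> d p (insert (idx s' 4 0) F) (num s' 6 0) (step settle s')"
    by (simp add: s2_def e_def r_def)
qed

text \<open>Progress is counted by settled players: a successful search adds one, and a failed
  search shows that nobody is left.\<close>

lemma runs_round:
  assumes "pd_nat {1..n} \<alpha> d p" and s: "filled n \<alpha> d p F t s"
    and count: "F = {1..n} - {p} \<or> j \<le> card F + 1" and j: "idx s 8 0 = j"
  shows "runs (Seq search settle) s ((n + 2) * ((n + 2) * ((n + 2) * 200 + 74) + 40) + 50)
    (\<lambda>s'. idx s' 8 0 = j \<and> (\<exists>F t. filled n \<alpha> d p F t s' \<and> (F = {1..n} - {p} \<or> Suc j \<le> card F + 1)))"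
proof (rule runs_Seq)
  have np: "idx s 0 0 = n" "idx s 2 0 = p" and F: "F \<subseteq> {1..n} - {p}" "settled s = insert p F"
    using s by (auto simp: filled_def)
  show "runs search s ((n + 2) * ((n + 2) * ((n + 2) * 200 + 74) + 40) + 10) (\<lambda>s'.
      agree {3, 4, 5, 6, 7} {4, 5, 6} s s' \<and> best s (({1..n} - {p}) \<times> {0..n}) s')"
    using runs_search[of s] unfolding np .
  fix s' assume *: "agree {3, 4, 5, 6, 7} {4, 5, 6} s s' \<and> best s (({1..n} - {p}) \<times> {0..n}) s'"
  show "runs settle s' 30 (\<lambda>s'. idx s' 8 0 = j \<and>
    (\<exists>F t. filled n \<alpha> d p F t s' \<and> (F = {1..n} - {p} \<or> Suc j \<le> card F + 1)))"
  proof (rule runs_loop_free)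
    show "idx (step settle s') 8 0 = j \<and> (\<exists>F t. filled n \<alpha> d p F t (step settle s')
      \<and> (F = {1..n} - {p} \<or> Suc j \<le> card F + 1))"
    proof (cases "idx s' 4 0 = 0")
      case True
      \<comment> \<open>An unsettled \<open>k\<close> would be an unsettled member of its own
        candidate \<open>coalition s k 0\<close>.\<close>
      have "F = {1..n} - {p}"
      proof (rule ccontr)
        assume "F \<noteq> {1..n} - {p}"
        then obtain k where k: "k \<in> {1..n} - {p}" "k \<notin> F" using F(1) by blast
        then have "k \<in> coalition s k 0 - settled s" using F np by (auto simp: coalition_def)
        moreover have "coalition s k 0 - settled s = {}"
          using * True k unfolding best_def by fastforce
        ultimately show False by blast
      qed
      moreover have "filled n \<alpha> d p F t s'"
        using s * by (rule_tac filled_agree) (auto simp: agree_def)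
      ultimately show ?thesis using True * j by (auto simp: settle_def agree_def)
    next
      case False
      let ?e = "idx s' 4 0"
      have e: "?e \<in> {1..n} - {p} - F"
        and f: "filled n \<alpha> d p (insert ?e F) (num s' 6 0) (step settle s')"
        using filled_settle[OF assms(1) s] * False by blast+
      have "finite F" using F finite_subset by blast
      then have "Suc j \<le> card (insert ?e F) + 1" if "j \<le> card F + 1"
        using e that by simp
      moreover have "j \<le> card F + 1" using count e by auto
      moreover have "idx (step settle s') 8 0 = j"
        using * j by (simp add: settle_def agree_def set_cell_def)
      ultimately show ?thesis using f by blast
    qed
  qed (simp_all add: settle_def)
qed simp

lemma runs_rounds:
  assumes game: "pd_nat {1..n} \<alpha> d p" and s: "filled n \<alpha> d p {} 0 s"
  shows "runs (For 8 1 (Seq search settle)) s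
    ((n + 2) * ((n + 2) * ((n + 2) * ((n + 2) * 200 + 74) + 40) + 50 + 14))
    (\<lambda>s'. \<exists>t. filled n \<alpha> d p ({1..n} - {p}) t s')"
proof (rule runs_For[where n = n and Inv = "\<lambda>j s'. idx s' 8 0 = j \<and>
    (\<exists>F t. filled n \<alpha> d p F t s' \<and> (F = {1..n} - {p} \<or> j \<le> card F + 1))"])
  interpret pd_nat "{1..n}" \<alpha> d p by fact
  have filled_set: "filled n \<alpha> d p F t (set_var 8 j s')" if "filled n \<alpha> d p F t s'" for F t j s'
    using that by (rule filled_agree) (auto simp: agree_def set_cell_def)
  show "idx (set_var 8 1 s) 8 0 = 1 \<and> (\<exists>F t. filled n \<alpha> d p F t (set_var 8 1 s)
      \<and> (F = {1..n} - {p} \<or> 1 \<le> card F + 1))"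
    using filled_set[OF s] by (auto simp: set_cell_def)
  fix s' assume "idx s' 8 0 = Suc n \<and>
    (\<exists>F t. filled n \<alpha> d p F t s' \<and> (F = {1..n} - {p} \<or> Suc n \<le> card F + 1))"
  then obtain F t where F: "filled n \<alpha> d p F t s'" "F = {1..n} - {p} \<or> Suc n \<le> card F + 1" by blast
  \<comment> \<open>The other alternative would need \<open>n\<close> settled players, but only
    \<open>n - 1\<close> are eligible.\<close>
  have "card F \<le> card ({1..n} - {p})"
    using F by (intro card_mono) (auto simp: filled_def)
  also have "\<dots> < n" using pN by simp
  finally show "\<exists>t. filled n \<alpha> d p ({1..n} - {p}) t s'" using F by auto
next
  fix j s'
  assume I: "idx s' 8 0 = j \<and>
    (\<exists>F t. filled n \<alpha> d p F t s' \<and> (F = {1..n} - {p} \<or> j \<le> card F + 1))"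
  have filled_set: "filled n \<alpha> d p F t (set_var 8 j s')" if "filled n \<alpha> d p F t s'" for F t j s'
    using that by (rule filled_agree) (auto simp: agree_def set_cell_def)
  obtain F t where F: "filled n \<alpha> d p F t s'" "F = {1..n} - {p} \<or> j \<le> card F + 1" using I by blast
  have "runs (Seq search settle) s' ((n + 2) * ((n + 2) * ((n + 2) * 200 + 74) + 40) + 50)
    (\<lambda>s'. idx s' 8 0 = j \<and> (\<exists>F t. filled n \<alpha> d p F t s' \<and> (F = {1..n} - {p} \<or> Suc j \<le> card F + 1)))"
    by (rule runs_round[OF game F]) (use I in simp)
  then show "runs (Seq search settle) s' ((n + 2) * ((n + 2) * ((n + 2) * 200 + 74) + 40) + 50)
    (\<lambda>s'. idx s' 8 0 = j \<and> idx (set_var 8 (Suc j) s') 8 0 = Suc j \<and>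
      (\<exists>F t. filled n \<alpha> d p F t (set_var 8 (Suc j) s') \<and> (F = {1..n} - {p} \<or> Suc j \<le> card F + 1)))"
  proof (rule runs_mono)
    fix s'' assume *: "idx s'' 8 0 = j \<and>
      (\<exists>F t. filled n \<alpha> d p F t s'' \<and> (F = {1..n} - {p} \<or> Suc j \<le> card F + 1))"
    moreover have "idx (set_var 8 (Suc j) s'') 8 0 = Suc j" by (simp add: set_cell_def)
    ultimately show "idx s'' 8 0 = j \<and> idx (set_var 8 (Suc j) s'') 8 0 = Suc j \<and>
      (\<exists>F t. filled n \<alpha> d p F t (set_var 8 (Suc j) s'') \<and> (F = {1..n} - {p} \<or> Suc j \<le> card F + 1))"
      using filled_set by blast
  qed simp
qed (auto simp: filled_def)

section \<open>Assembling the phases\<close>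

lemma nucleolus_cong:
  assumes "\<And>S. S \<subseteq> N \<Longrightarrow> v S = v' S"
  shows "nucleolus N v = nucleolus N v'"
proof -
  have "excess_vector N v x = excess_vector N v' x" for x
    unfolding excess_vector_def excess_def using assms
    by (cases "finite N") (auto intro!: arg_cong[where f = sorted_list_of_multiset] image_mset_cong)
  moreover have "efficient N v = efficient N v'"
    using assms[OF order_refl] by (simp add: efficient_def)
  ultimately show ?thesis by (simp add: nucleolus_def)
qed

definition time_bound :: "nat \<Rightarrow> nat" where
  "time_bound n = (n + 2) * 50 + (n + 2) * ((n + 2) * ((n + 2) * ((n + 2) * 200 + 74) + 40) + 64)
     + (n + 2) * 50 + 60"

lemma runs_nucleolus_program:
  assumes nonneg: "\<forall>i\<in>{1..n}. 0 \<le> \<alpha> i \<and> 0 \<le> d i"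
  shows "runs nucleolus_program (pd_input n \<alpha> d) (time_bound n)
    (\<lambda>s. nucleolus {1..n} (pd_value \<alpha> d) = {pd_output n s})"
proof -
  define s0 where "s0 = pd_input n \<alpha> d"
  define a b where "a = num s0 0" and "b = num s0 1"
  have n: "idx s0 0 0 = n" by (simp add: s0_def pd_input_def set_cell_def)
  have ab: "a i = \<alpha> i" "b i = d i" if "i \<in> {1..n}" for i
    using that by (simp_all add: a_def b_def s0_def pd_input_def)
  have init: "b 0 = 0" "num s0 3 = (\<lambda>i. 0)" "num s0 7 = (\<lambda>i. 0)" "idx s0 1 = (\<lambda>i. 0)"
    by (auto simp: b_def s0_def pd_input_def set_cell_def)
  \<comment> \<open>\<open>a\<close> and \<open>b\<close> are the contents of the input arrays,
    which vanish outside the players; this provides \<open>b 0 = 0\<close> for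
    \<open>pd_nat\<close>, whereas \<open>d 0\<close> is arbitrary.\<close>
  have nucleolus_eq: "nucleolus {1..n} (pd_value \<alpha> d) = nucleolus {1..n} (pd_value a b)"
  proof (rule nucleolus_cong)
    fix S assume "S \<subseteq> {1..n}"
    then have "a ` S = \<alpha> ` S" "sum b S = sum d S" using ab by (auto intro!: image_cong sum.cong)
    then show "pd_value \<alpha> d S = pd_value a b S" by (simp add: pd_value_def)
  qed
  show ?thesis
    unfolding nucleolus_program_def s0_def[symmetric] nucleolus_eq
  proof (rule runs_Seq)
    show "runs find_top s0 ((n + 2) * 50 + 20) (\<lambda>s'. let p = idx s' 2 0 in agree {1, 2, 5} {} s0 s'
      \<and> idx s' 1 = (idx s0 1)(p := 1)
      \<and> (1 \<le> n \<longrightarrow> p \<in> {1..n} \<and> (\<forall>i\<in>{1..n}. num s0 0 i \<le> num s0 0 p)))"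
      using runs_find_top[of s0] unfolding n .
    fix s1 :: state
    define p where "p = idx s1 2 0"
    assume "let p = idx s1 2 0 in agree {1, 2, 5} {} s0 s1 \<and> idx s1 1 = (idx s0 1)(p := 1)
      \<and> (1 \<le> n \<longrightarrow> p \<in> {1..n} \<and> (\<forall>i\<in>{1..n}. num s0 0 i \<le> num s0 0 p))"
    then have s1: "agree {1, 2, 5} {} s0 s1" "idx s1 1 = (idx s0 1)(p := 1)"
      and p: "1 \<le> n \<Longrightarrow> p \<in> {1..n} \<and> (\<forall>i\<in>{1..n}. a i \<le> a p)"
      by (simp_all add: p_def a_def Let_def)
    let ?T = "(n + 2) * ((n + 2) * ((n + 2) * ((n + 2) * 200 + 74) + 40) + 50 + 14)"
    show "runs (Seq (For 8 1 (Seq search settle)) write_payoffs) s1 (?T + ((n + 2) * 50 + 20) + 1)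
      (\<lambda>s. nucleolus {1..n} (pd_value a b) = {pd_output n s})"
    proof (cases "n = 0")
      \<comment> \<open>Without players there is no \<open>p\<close> for the locale. The rounds are
        not entered, and the nucleolus consists of the function that is \<open>undefined\<close>
        everywhere, which is also the output.\<close>
      case True
      have unique: "nucleolus {1..n} (pd_value a b) = {pd_output n s}" for s
        using True by (intro nucleolus_eqI)
          (auto simp: efficient_def pd_output_def pd_value_def restrict_def)
      show ?thesis
      proof (rule runs_Seq)
        show "runs (For 8 1 (Seq search settle)) s1 ?T (\<lambda>s. idx s 0 0 = 0)"
          by (rule runs_For[where n = n and Inv = "\<lambda>j s. idx s 0 0 = n \<and> idx s 8 0 = j"])
            (use True n s1 in \<open>auto simp: agree_def set_cell_def\<close>)
        show "runs write_payoffs s ((n + 2) * 50 + 20) (\<lambda>s. nucleolus {1..n} (pd_value a b) = {pd_output n s})"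
          if "idx s 0 0 = 0" for s
          using runs_write_payoffs[of s] unfolding that True by (rule runs_mono) (use unique True in auto)
      qed simp
    next
      case False
      interpret pd_nat "{1..n}" a b p
        using p False nonneg ab init by unfold_locales auto
      have "idx s1 0 = idx s0 0" "num s1 = num s0"
        using s1(1) by (auto simp: agree_def)
      then have "idx s1 0 0 = n" "num s1 0 = a" "num s1 1 = b" "num s1 3 = (\<lambda>i. 0)" "num s1 7 0 = 0"
        using n init by (simp_all add: a_def b_def)
      moreover have "settled s1 = {p}"
        unfolding settled_def s1(2) init by auto
      ultimately have "filled n a b p {} 0 s1"
        using equitable_zero unfolding filled_def p_def[symmetric] by simp
      note rounds = runs_rounds[OF pd_nat_axioms this]
      show ?thesis
      proof (rule runs_Seq[OF rounds])
        fix s2 assume "\<exists>t. filled n a b p ({1..n} - {p}) t s2"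
        then obtain t where s2: "filled n a b p ({1..n} - {p}) t s2" ..
        define y where "y = num s2 3"
        have y: "y p = 0" and eq: "equitable (\<lambda>i. if i \<in> {1..n} - {p} then y i else t) ({1..n} - {p})"
          and n2: "idx s2 0 0 = n" "idx s2 2 0 = p" "num s2 0 = a" "num s2 1 = b" "num s2 7 0 = 0"
          using s2 pN unfolding filled_def y_def[symmetric] by simp_all
        \<comment> \<open>Everybody but \<open>p\<close> is settled, so inside the player set the
          two arguments differ at most at \<open>p\<close>, where \<open>payoff\<close> does not
          evaluate them.\<close>
        have "payoff (\<lambda>i. if i \<in> {1..n} - {p} then y i else t) = payoff y"
          unfolding payoff_def by (intro restrict_ext) (auto intro: sum.cong)
        then have nuc: "nucleolus {1..n} (pd_value a b) = {payoff y}"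
          using nucleolus_equitable[OF eq] by simp
        have total: "sum y {1..n} = sum y ({1..n} - {p})"
          using sum.remove[OF fin pN, of y] y by simp
        show "runs write_payoffs s2 ((n + 2) * 50 + 20)
          (\<lambda>s. nucleolus {1..n} (pd_value a b) = {pd_output n s})"
          using runs_write_payoffs[of s2] unfolding n2
        proof (rule runs_mono)
          fix s :: state assume "\<forall>i\<in>{1..n}. num s 2 i = a p * b i - num s2 3 i
            + (if i = p then 0 + sum (num s2 3) {1..n} else 0)"
          then have "pd_output n s = payoff y"
            unfolding pd_output_def payoff_def using y total
            by (intro restrict_ext) (simp flip: y_def)
          then show "nucleolus {1..n} (pd_value a b) = {pd_output n s}" using nuc by simp
        qed simp
      qed simp
    qed
  qed (simp add: time_bound_def)
qed

theorem theorem1: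
  "\<exists>(P :: com) (T :: nat \<Rightarrow> nat).
     (\<lambda>n. real (T n)) \<in> O(\<lambda>n. real n ^ 4) \<and>
     (\<forall>(n :: nat) (\<alpha> :: nat \<Rightarrow> real) (d :: nat \<Rightarrow> real).
        (\<forall>i\<in>{1..n}. 0 \<le> \<alpha> i \<and> 0 \<le> d i) \<longrightarrow>
        (\<exists>t s. exec P (pd_input n \<alpha> d) t s \<and> t \<le> T n \<and>
               nucleolus {1..n} (pd_value \<alpha> d) = {pd_output n s}))"
proof (rule exI[of _ nucleolus_program], rule exI[of _ time_bound], intro conjI allI impI)
  show "(\<lambda>n. real (time_bound n)) \<in> O(\<lambda>n. real n ^ 4)"
    unfolding time_bound_def of_nat_add of_nat_mult of_nat_numeral by real_asymp
  fix n :: nat and \<alpha> d :: "nat \<Rightarrow> real"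
  assume "\<forall>i\<in>{1..n}. 0 \<le> \<alpha> i \<and> 0 \<le> d i"
  from runs_nucleolus_program[OF this, unfolded runs_def]
  show "\<exists>t s. exec nucleolus_program (pd_input n \<alpha> d) t s \<and> t \<le> time_bound n \<and>
    nucleolus {1..n} (pd_value \<alpha> d) = {pd_output n s}" .
qed

end
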